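(* For $i\in\{1,2\}$, $$\frac{n-4}{3}\le s_i(n,\# K_3,P_5)\le \frac{n-4}{3}+4.$$
   Context: For graphs $F$ and $H$, the $F$-saturation game on $n$ vertices is played by Max and Mini, who alternately claim previously unclaimed edges of $K_n$ so that the graph $G$ of claimed edges stays $F$-free; the game ends when $G$ is $F$-saturated. The $H$-score is the number of (not necessarily induced) subgraphs of the final $G$ isomorphic to $H$. Max maximizes, Mini minimizes the score; $s_1(n,\# H,F)$ is the optimal score when Max starts, $s_2(n,\# H,F)$ when Mini starts. $K_3$ is the triangle and $P_5$ the path on 5 vertices. *)

theory Defs
  imports Complex_Main "HOL-Library.Ramsey"
begin

text \<open>A graph is a pair of a vertex set and an edge set; edges are 2-element sets of vertices.
  From \<^theory>\<open>HOL-Library.Ramsey\<close>, \<open>[V]\<^bsup>2\<^esup>\<close> is the set of all 2-element subsets of \<open>V\<close>.\<close>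

type_synonym 'a graph = "'a set \<times> 'a set set"

definition is_graph :: "'a graph \<Rightarrow> bool" where
  "is_graph G \<longleftrightarrow> snd G \<subseteq> [fst G]\<^bsup>2\<^esup>"

definition subgraph_of :: "'a graph \<Rightarrow> 'a graph \<Rightarrow> bool" where
  "subgraph_of K G \<longleftrightarrow> is_graph K \<and> fst K \<subseteq> fst G \<and> snd K \<subseteq> snd G"

definition isomorphic :: "'a graph \<Rightarrow> 'b graph \<Rightarrow> bool" where
  "isomorphic G K \<longleftrightarrow> (\<exists>f. bij_betw f (fst G) (fst K) \<and> (\<lambda>e. f ` e) ` snd G = snd K)"

definition copies :: "'h graph \<Rightarrow> 'a graph \<Rightarrow> 'a graph set" where
  "copies H G = {K. subgraph_of K G \<and> isomorphic H K}"

definition complete_graph :: "nat \<Rightarrow> nat graph" where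
  "complete_graph k = ({..<k}, [{..<k}]\<^bsup>2\<^esup>)"

definition path_graph :: "nat \<Rightarrow> nat graph" where
  "path_graph k = ({..<k}, {{i, Suc i} | i. Suc i < k})"

text \<open>The board of the game is the complete graph on \<open>{..<n}\<close>; a position is the set \<open>E\<close> of
  edges claimed so far.\<close>

definition F_free :: "nat \<Rightarrow> 'f graph \<Rightarrow> nat set set \<Rightarrow> bool" where
  "F_free n F E \<longleftrightarrow> copies F ({..<n}, E) = {}"

definition saturated :: "nat \<Rightarrow> 'f graph \<Rightarrow> nat set set \<Rightarrow> bool" where
  "saturated n F E \<longleftrightarrow> F_free n F E \<and> (\<forall>e \<in> [{..<n}]\<^bsup>2\<^esup> - E. \<not> F_free n F (insert e E))"

definition legal_moves :: "nat \<Rightarrow> 'f graph \<Rightarrow> nat set set \<Rightarrow> nat set set" where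
  "legal_moves n F E = {e \<in> [{..<n}]\<^bsup>2\<^esup> - E. F_free n F (insert e E)}"

lemma no_legal_moves_iff_saturated:
  "F_free n F E \<Longrightarrow> legal_moves n F E = {} \<longleftrightarrow> saturated n F E"
  by (auto simp: legal_moves_def saturated_def)

lemma finite_legal_moves: "finite (legal_moves n F E)"
  by (rule finite_subset[of _ "[{..<n}]\<^bsup>2\<^esup>"])
     (auto simp: legal_moves_def finite_imp_finite_nsets)

lemma legal_move_decreases:
  assumes "e \<in> legal_moves n F E"
  shows "card ([{..<n}]\<^bsup>2\<^esup> - insert e E) < card ([{..<n}]\<^bsup>2\<^esup> - E)"
proof (rule psubset_card_mono)
  show "finite ([{..<n}]\<^bsup>2\<^esup> - E)"
    by (simp add: finite_imp_finite_nsets)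
  show "[{..<n}]\<^bsup>2\<^esup> - insert e E \<subset> [{..<n}]\<^bsup>2\<^esup> - E"
    using assms by (auto simp: legal_moves_def)
qed

datatype player = Max_player | Mini_player

text \<open>The \<open>H\<close>-score of the final graph under optimal play from position \<open>E\<close> with the given player
  to move. Along any play from an \<open>F\<close>-free position all positions are \<open>F\<close>-free, so the game is
  over exactly when the position is \<open>F\<close>-saturated (lemma \<open>no_legal_moves_iff_saturated\<close>).\<close>

function optimal_score ::
    "nat \<Rightarrow> 'h graph \<Rightarrow> 'f graph \<Rightarrow> player \<Rightarrow> nat set set \<Rightarrow> nat" where
  "optimal_score n H F p E =
    (if legal_moves n F E = {} then card (copies H ({..<n}, E))
     else case p of
       Max_player \<Rightarrow> Max ((\<lambda>e. optimal_score n H F Mini_player (insert e E)) ` legal_moves n F E)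
     | Mini_player \<Rightarrow> Min ((\<lambda>e. optimal_score n H F Max_player (insert e E)) ` legal_moves n F E))"
  by pat_completeness auto
termination
  by (relation "measure (\<lambda>(n, H, F, p, E). card ([{..<n}]\<^bsup>2\<^esup> - E))")
     (auto intro: legal_move_decreases)

declare optimal_score.simps [simp del]

definition s\<^sub>1 :: "nat \<Rightarrow> 'h graph \<Rightarrow> 'f graph \<Rightarrow> nat" where
  "s\<^sub>1 n H F = optimal_score n H F Max_player {}"

definition s\<^sub>2 :: "nat \<Rightarrow> 'h graph \<Rightarrow> 'f graph \<Rightarrow> nat" where
  "s\<^sub>2 n H F = optimal_score n H F Mini_player {}"

end

theory Submission
  imports Defs "HOL-Library.Disjoint_Sets"
begin

text \<open>Both strategies depend on little more than the sizes of the connected components. A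
  \<open>P\<^sub>5\<close>-free component has at most one triangle if it has at least 5 vertices, and at most four
  triangles if it has 4.

  Mini lets at most one component of size 4 survive. As long as there is an isolated vertex, she
  destroys a component of size 4 that Max has just made by joining an isolated vertex to the
  neighbour of one of its leaves, and otherwise she keeps the number of components of size 2 at
  most 1. Thus only one component can have more triangles than a third of its size, and
  it contributes the excess \<open>4 - 4/3 = 8/3\<close>.

  Max keeps every component small (at most 4 vertices) and with a Hamiltonian path from each
  of its vertices. Two such components can be joined without a \<open>P\<^sub>5\<close> only if they have at most
  4 vertices together; then Max closes a Hamiltonian cycle. At the end the components of size at
  most 4 are complete and at most one of them has less than 3 vertices. The exception is the
  parity problem that arises when Max has to move with one isolated vertex left: it may cost him one
  component with 5 vertices and one triangle, which again loses only \<open>2/3\<close>.\<close>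

section \<open>Bounding the optimal score by invariants\<close>

text \<open>\<open>Q\<close> is a certificate for Mini: every move of Max has to preserve it, but
  only one move of Mini. \<open>stop\<close> covers both players, since the game may end on either
  turn. The induction is on the number of unclaimed edges.\<close>

lemma optimal_score_le:
  assumes stop: "\<And>p E. Q p E \<Longrightarrow> legal_moves n F E = {} \<Longrightarrow> card (copies H ({..<n}, E)) \<le> B"
    and max: "\<And>E e. Q Max_player E \<Longrightarrow> e \<in> legal_moves n F E \<Longrightarrow> Q Mini_player (insert e E)"
    and mini: "\<And>E. Q Mini_player E \<Longrightarrow> legal_moves n F E \<noteq> {} \<Longrightarrow>
      \<exists>e \<in> legal_moves n F E. Q Max_player (insert e E)"
  shows "Q p E \<Longrightarrow> optimal_score n H F p E \<le> B"
proof (induction "card ([{..<n}]\<^bsup>2\<^esup> - E)" arbitrary: p E rule: less_induct)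
  case less
  note IH = less(1)[OF legal_move_decreases[where F = F]]
  let ?L = "legal_moves n F E"
  show ?case
  proof (cases "?L = {}")
    case True
    then show ?thesis using stop[OF less(2)] by (simp add: optimal_score.simps[of n H F p E])
  next
    case False
    show ?thesis
    proof (cases p)
      case Max_player
      then show ?thesis
        using False IH max less(2)
        by (simp add: optimal_score.simps[of n H F Max_player E] finite_legal_moves)
    next
      case Mini_player
      then obtain e where e: "e \<in> ?L" "Q Max_player (insert e E)"
        using mini False less(2) by blast
      have "optimal_score n H F p E \<le> optimal_score n H F Max_player (insert e E)"
        using False Mini_player e(1)
        by (auto simp: optimal_score.simps[of n H F Mini_player E] finite_legal_moves intro!: Min_le)
      then show ?thesis using IH[OF e] by linarith
    qed
  qed
qed

text \<open>The mirror image with the roles exchanged: now only one good move of Max is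
  required.\<close>

lemma optimal_score_ge:
  assumes stop: "\<And>p E. Q p E \<Longrightarrow> legal_moves n F E = {} \<Longrightarrow> B \<le> card (copies H ({..<n}, E))"
    and mini: "\<And>E e. Q Mini_player E \<Longrightarrow> e \<in> legal_moves n F E \<Longrightarrow> Q Max_player (insert e E)"
    and max: "\<And>E. Q Max_player E \<Longrightarrow> legal_moves n F E \<noteq> {} \<Longrightarrow>
      \<exists>e \<in> legal_moves n F E. Q Mini_player (insert e E)"
  shows "Q p E \<Longrightarrow> B \<le> optimal_score n H F p E"
proof (induction "card ([{..<n}]\<^bsup>2\<^esup> - E)" arbitrary: p E rule: less_induct)
  case less
  note IH = less(1)[OF legal_move_decreases[where F = F]]
  let ?L = "legal_moves n F E"
  show ?case
  proof (cases "?L = {}")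
    case True
    then show ?thesis using stop[OF less(2)] by (simp add: optimal_score.simps[of n H F p E])
  next
    case False
    show ?thesis
    proof (cases p)
      case Mini_player
      then show ?thesis
        using False IH mini less(2)
        by (simp add: optimal_score.simps[of n H F Mini_player E] finite_legal_moves)
    next
      case Max_player
      then obtain e where e: "e \<in> ?L" "Q Mini_player (insert e E)"
        using max False less(2) by blast
      have "optimal_score n H F Mini_player (insert e E) \<le> optimal_score n H F p E"
        using False Max_player e(1)
        by (auto simp: optimal_score.simps[of n H F Max_player E] finite_legal_moves intro!: Max_ge)
      then show ?thesis using IH[OF e] by linarith
    qed
  qed
qed

section \<open>Paths on five vertices and triangles\<close>

text \<open>The path is given by its vertices, without board or isomorphism;
  \<open>F_free_P5\<close> links it to the game.\<close>

definition has_P5 :: "'a set set \<Rightarrow> bool" where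
  "has_P5 E \<longleftrightarrow> (\<exists>a b c d e. distinct [a, b, c, d, e] \<and>
     {a, b} \<in> E \<and> {b, c} \<in> E \<and> {c, d} \<in> E \<and> {d, e} \<in> E)"

lemma has_P5I:
  assumes "distinct [a, b, c, d, e]" "{a, b} \<in> E" "{b, c} \<in> E" "{c, d} \<in> E" "{d, e} \<in> E"
  shows "has_P5 E"
  unfolding has_P5_def using assms by (intro exI conjI)

lemma has_P5E:
  assumes "has_P5 E"
  obtains a b c d e where "distinct [a, b, c, d, e]" "{a, b} \<in> E" "{b, c} \<in> E" "{c, d} \<in> E" "{d, e} \<in> E"
  using assms unfolding has_P5_def by (elim exE conjE) (rule that)

definition triangles :: "'a set set \<Rightarrow> 'a set set" where
  "triangles E = {t. card t = 3 \<and> [t]\<^bsup>2\<^esup> \<subseteq> E}"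

lemma path_graph_5: "path_graph 5 = ({..<5}, {{0, 1}, {1, 2}, {2, 3}, {3, 4}})"
proof -
  have "{{i, Suc i} |i. Suc i < 5} = (\<lambda>i. {i, i + 1}) ` {i. Suc i < 5}"
    by auto
  also have "{i. Suc i < 5} = {0, 1, 2, 3}"
    by auto
  also have "(\<lambda>i. {i, i + 1}) ` {0, 1, 2, 3 :: nat} = {{0, 1}, {1, 2}, {2, 3}, {3, 4}}"
    by (simp del: One_nat_def)
  finally show ?thesis by (simp only: path_graph_def)
qed

text \<open>A copy yields the path as the images of 0 to 4. Conversely, indexing the list of path
  vertices gives the isomorphism, and they lie on the board because every edge does.\<close>

lemma F_free_P5:
  assumes "E \<subseteq> [{..<n}]\<^bsup>2\<^esup>"
  shows "F_free n (path_graph 5) E \<longleftrightarrow> \<not> has_P5 E"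
proof -
  have dist: "distinct [f 0, f 1, f 2, f 3, f 4]" if "inj_on f {..<5}" for f :: "nat \<Rightarrow> nat"
    using that by (simp add: inj_on_eq_iff)
  have "has_P5 E" if K: "K \<in> copies (path_graph 5) ({..<n}, E)" for K
  proof -
    obtain f :: "nat \<Rightarrow> nat" where f: "bij_betw f {..<5} (fst K)"
      "(`) f ` {{0, 1}, {1, 2}, {2, 3}, {3, 4}} = snd K" "snd K \<subseteq> E"
      using K by (auto simp: copies_def subgraph_of_def isomorphic_def path_graph_5)
    have "{f 0, f 1} \<in> E" "{f 1, f 2} \<in> E" "{f 2, f 3} \<in> E" "{f 3, f 4} \<in> E"
      using f(2,3) by auto
    then show ?thesis
      using f(1) by (intro has_P5I[OF dist]) (simp_all add: bij_betw_def)
  qed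
  moreover have "copies (path_graph 5) ({..<n}, E) \<noteq> {}" if P5: "has_P5 E"
  proof -
    obtain a b c d e where d: "distinct [a, b, c, d, e]"
      and E: "{a, b} \<in> E" "{b, c} \<in> E" "{c, d} \<in> E" "{d, e} \<in> E"
      by (rule has_P5E[OF P5])
    let ?K = "({a, b, c, d, e}, {{a, b}, {b, c}, {c, d}, {d, e}})"
    let ?f = "\<lambda>i. [a, b, c, d, e] ! i"
    have "bij_betw ?f {..<5} {a, b, c, d, e}"
      by (rule bij_betw_nth[OF d]) auto
    moreover have "(`) ?f ` {{0, 1}, {1, 2}, {2, 3}, {3, 4}} = {{a, b}, {b, c}, {c, d}, {d, e}}"
      by simp
    ultimately have "isomorphic (path_graph 5) ?K"
      unfolding isomorphic_def path_graph_5 fst_conv snd_conv by blast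
    moreover have "is_graph ?K"
      using d by (simp add: is_graph_def)
    moreover have "{a, b, c, d, e} \<subseteq> {..<n}"
      using E[THEN subsetD[OF assms]] by simp
    ultimately have "?K \<in> copies (path_graph 5) ({..<n}, E)"
      using E by (auto simp: copies_def subgraph_of_def)
    then show ?thesis by blast
  qed
  ultimately show ?thesis unfolding F_free_def by blast
qed

lemma legal_moves_P5:
  assumes "E \<subseteq> [{..<n}]\<^bsup>2\<^esup>"
  shows "e \<in> legal_moves n (path_graph 5) E \<longleftrightarrow>
    e \<in> [{..<n}]\<^bsup>2\<^esup> \<and> e \<notin> E \<and> \<not> has_P5 (insert e E)"
  using F_free_P5[of "insert e E" n] assms by (auto simp: legal_moves_def)

text \<open>A copy of the triangle contains all pairs of its three vertices, so it is determined by
  its vertex set.\<close>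

lemma card_copies_K3:
  fixes n :: nat
  assumes "E \<subseteq> [{..<n}]\<^bsup>2\<^esup>"
  shows "card (copies (complete_graph 3) ({..<n}, E)) = card (triangles E)"
proof -
  have "copies (complete_graph 3) ({..<n}, E) = (\<lambda>t. (t, [t]\<^bsup>2\<^esup>)) ` triangles E"
  proof (intro equalityI subsetI)
    fix K assume "K \<in> copies (complete_graph 3) ({..<n}, E)"
    then obtain f :: "nat \<Rightarrow> nat" where f: "bij_betw f {..<3} (fst K)" "(`) f ` [{..<3}]\<^bsup>2\<^esup> = snd K"
      "snd K \<subseteq> E"
      by (auto simp: copies_def subgraph_of_def isomorphic_def complete_graph_def)
    have "[fst K]\<^bsup>2\<^esup> = snd K"
      using bij_betw_nsets[OF f(1), of 2] f(2) by (simp add: bij_betw_def)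
    moreover have "card (fst K) = 3" using bij_betw_same_card[OF f(1)] by simp
    ultimately show "K \<in> (\<lambda>t. (t, [t]\<^bsup>2\<^esup>)) ` triangles E"
      using f(3) by (intro image_eqI[of _ _ "fst K"]) (auto simp: triangles_def prod_eq_iff)
  next
    fix K assume "K \<in> (\<lambda>t. (t, [t]\<^bsup>2\<^esup>)) ` triangles E"
    then obtain t where K: "K = (t, [t]\<^bsup>2\<^esup>)" and t: "card t = 3" "[t]\<^bsup>2\<^esup> \<subseteq> E"
      by (auto simp: triangles_def)
    obtain f where f: "bij_betw f {..<3::nat} t"
      using t(1) bij_betw_iff_card[of "{..<3::nat}" t] card_ge_0_finite[of t] by auto
    have "(`) f ` [{..<3}]\<^bsup>2\<^esup> = [t]\<^bsup>2\<^esup>"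
      using bij_betw_nsets[OF f, of 2] by (simp add: bij_betw_def)
    then have "isomorphic (complete_graph 3) K"
      using f by (auto simp: isomorphic_def complete_graph_def K)
    moreover have "t \<subseteq> {..<n}"
    proof
      fix x assume x: "x \<in> t"
      obtain y where "y \<in> t" "y \<noteq> x"
        using t(1) by (auto simp: card_Suc_eq numeral_3_eq_3)
      then have "{x, y} \<in> [t]\<^bsup>2\<^esup>" using x by auto
      then have "{x, y} \<in> [{..<n}]\<^bsup>2\<^esup>" using t(2) assms by blast
      then show "x \<in> {..<n}" by simp
    qed
    ultimately show "K \<in> copies (complete_graph 3) ({..<n}, E)"
      using t by (auto simp: copies_def subgraph_of_def is_graph_def K)
  qed
  moreover have "inj_on (\<lambda>t. (t, [t]\<^bsup>2\<^esup>)) (triangles E)" by (rule inj_onI) simp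
  ultimately show ?thesis by (simp add: card_image)
qed

section \<open>Positions and their blocks\<close>

text \<open>For a graph this says that \<open>Z\<close> is a union of connected components.\<close>

definition closed_under :: "'a set set \<Rightarrow> 'a set \<Rightarrow> bool" where
  "closed_under E Z \<longleftrightarrow> (\<forall>e \<in> E. e \<inter> Z \<noteq> {} \<longrightarrow> e \<subseteq> Z)"

lemma closed_underD: "closed_under E Z \<Longrightarrow> {x, y} \<in> E \<Longrightarrow> x \<in> Z \<longleftrightarrow> y \<in> Z"
  unfolding closed_under_def by (cases "x \<in> Z"; cases "y \<in> Z"; force)

lemma closed_under_Un: "closed_under E Y \<Longrightarrow> closed_under E Z \<Longrightarrow> closed_under E (Y \<union> Z)"
  unfolding closed_under_def by blast

lemma closed_under_insert: "closed_under E Z \<Longrightarrow> e \<subseteq> Z \<Longrightarrow> closed_under (insert e E) Z"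
  unfolding closed_under_def by blast

text \<open>A new path must use \<open>e\<close>, which lies in \<open>Z\<close>, and a path cannot
  cross the border of a closed set.\<close>

lemma P5_confined:
  assumes "closed_under E Z" "e \<subseteq> Z" "\<not> has_P5 E" "distinct [a, b, c, d, f]"
    and E: "{a, b} \<in> insert e E" "{b, c} \<in> insert e E" "{c, d} \<in> insert e E" "{d, f} \<in> insert e E"
  shows "{a, b, c, d, f} \<subseteq> Z"
proof -
  have cl: "closed_under (insert e E) Z" by (rule closed_under_insert) fact+
  note E[THEN closed_underD[OF cl]]
  moreover have "a \<in> Z"
  proof (rule ccontr)
    assume "a \<notin> Z"
    with calculation have "{a, b} \<noteq> e" "{b, c} \<noteq> e" "{c, d} \<noteq> e" "{d, f} \<noteq> e"
      using assms(2) by auto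
    then show False using E assms(3,4) has_P5I[of a b c d f E] by simp
  qed
  ultimately show ?thesis by simp
qed

lemma not_P5_insert_small:
  assumes "closed_under E Z" "e \<subseteq> Z" "\<not> has_P5 E" "finite Z" "card Z \<le> 4"
  shows "\<not> has_P5 (insert e E)"
proof
  assume "has_P5 (insert e E)"
  then obtain a b c d f where d: "distinct [a, b, c, d, f]" and "{a, b} \<in> insert e E"
    "{b, c} \<in> insert e E" "{c, d} \<in> insert e E" "{d, f} \<in> insert e E"
    by (rule has_P5E)
  then have "{a, b, c, d, f} \<subseteq> Z" by (rule P5_confined[OF assms(1-3)])
  then have "card {a, b, c, d, f} \<le> 4"
    using card_mono[OF assms(4)] assms(5) by (meson le_trans)
  then show False using d by simp
qed

text \<open>A Hamiltonian path of a 5-element block would have to end in both leaves, and so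
  its second and its fourth vertex would coincide.\<close>

lemma not_P5_insert_leaves:
  assumes "closed_under E Z" "e \<subseteq> Z" "\<not> has_P5 E" "finite Z" "card Z = 5"
    and xy: "x \<in> Z" "y \<in> Z" "x \<noteq> y"
    and x: "\<And>z. {x, z} \<in> insert e E \<Longrightarrow> z = c"
    and y: "\<And>z. {y, z} \<in> insert e E \<Longrightarrow> z = c"
  shows "\<not> has_P5 (insert e E)"
proof
  assume "has_P5 (insert e E)"
  then obtain p q r s t where d: "distinct [p, q, r, s, t]" and E: "{p, q} \<in> insert e E"
    "{q, r} \<in> insert e E" "{r, s} \<in> insert e E" "{s, t} \<in> insert e E"
    by (rule has_P5E)
  then have "{p, q, r, s, t} \<subseteq> Z" by (rule P5_confined[OF assms(1-3)])
  moreover have "card {p, q, r, s, t} = 5" using d by simp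
  ultimately have Z: "Z = {p, q, r, s, t}"
    using assms(4,5) by (metis card_subset_eq)
  have E': "{q, p} \<in> insert e E" "{r, q} \<in> insert e E" "{s, r} \<in> insert e E" "{t, s} \<in> insert e E"
    using E by (simp_all only: insert_commute)
  have "w = p \<or> w = t" if "w \<in> Z" and w: "\<And>z. {w, z} \<in> insert e E \<Longrightarrow> z = c" for w
  proof -
    have "p = r" if "w = q" using w[of p] w[of r] E'(1) E(2) that by simp
    moreover have "q = s" if "w = r" using w[of q] w[of s] E'(2) E(3) that by simp
    moreover have "r = t" if "w = s" using w[of r] w[of t] E'(3) E(4) that by simp
    moreover have "p \<noteq> r" "q \<noteq> s" "r \<noteq> t" using d by simp_all
    moreover have "w = p \<or> w = q \<or> w = r \<or> w = s \<or> w = t" using \<open>w \<in> Z\<close> unfolding Z by simp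
    ultimately show ?thesis by metis
  qed
  from this[OF xy(1) x] this[OF xy(2) y] have "{x, y} = {p, t}" using xy(3) by auto
  then consider "x = p" "y = t" | "x = t" "y = p" by (auto simp: doubleton_eq_iff)
  then have "q = c \<and> s = c" using x y E(1) E'(4) by cases blast+
  then show False using d by simp
qed

text \<open>The blocks of \<open>P\<close> are meant to be the connected components, but connectedness is only
  imposed later, by each player's invariant in the form it needs.\<close>

definition position :: "nat \<Rightarrow> nat set set \<Rightarrow> nat set set \<Rightarrow> bool" where
  "position n E P \<longleftrightarrow> E \<subseteq> [{..<n}]\<^bsup>2\<^esup> \<and> \<not> has_P5 E \<and> partition_on {..<n} P \<and>
     (\<forall>e \<in> E. \<exists>C \<in> P. e \<subseteq> C)"

definition merge :: "'a set set \<Rightarrow> 'a set \<Rightarrow> 'a set \<Rightarrow> 'a set set" where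
  "merge P C D = insert (C \<union> D) (P - {C, D})"

lemma position_disjoint:
  "position n E P \<Longrightarrow> C \<in> P \<Longrightarrow> D \<in> P \<Longrightarrow> x \<in> C \<Longrightarrow> x \<in> D \<Longrightarrow> C = D"
  unfolding position_def partition_on_def disjoint_def by blast

lemma position_finite: "position n E P \<Longrightarrow> finite P"
  unfolding position_def using finite_elements[of "{..<n}" P] by simp

lemma position_block:
  assumes "position n E P" "C \<in> P"
  shows "finite C" "C \<noteq> {}" "C \<subseteq> {..<n}" "card C \<ge> 1"
proof -
  show C: "C \<noteq> {}" "C \<subseteq> {..<n}"
    using assms unfolding position_def partition_on_def by auto
  then show "finite C" by (meson finite_lessThan finite_subset)
  with C show "card C \<ge> 1" by (simp add: Suc_le_eq card_gt_0_iff)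
qed

lemma position_cover: "position n E P \<Longrightarrow> x < n \<Longrightarrow> \<exists>C \<in> P. x \<in> C"
  unfolding position_def partition_on_def by auto

lemma position_closed: "position n E P \<Longrightarrow> C \<in> P \<Longrightarrow> closed_under E C"
  unfolding closed_under_def
proof (intro ballI impI)
  fix e assume "position n E P" "C \<in> P" "e \<in> E" "e \<inter> C \<noteq> {}"
  moreover then obtain D where "D \<in> P" "e \<subseteq> D" unfolding position_def by blast
  ultimately show "e \<subseteq> C" using position_disjoint by blast
qed

lemma position_card: "position n E P \<Longrightarrow> (\<Sum>C\<in>P. card C) = n"
  using product_partition[of "{..<n}" P] position_block(1)
  unfolding position_def by (metis card_lessThan)

lemma position_nsets: "position n E P \<Longrightarrow> E \<subseteq> [{..<n}]\<^bsup>2\<^esup>"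
  unfolding position_def by blast

lemma position_not_P5: "position n E P \<Longrightarrow> \<not> has_P5 E"
  unfolding position_def by blast

lemma position_edge: "position n E P \<Longrightarrow> e \<in> E \<Longrightarrow> \<exists>C \<in> P. e \<subseteq> C"
  unfolding position_def by blast

text \<open>During the game this makes most of the chosen moves legal; at its end it forces blocks
  of at most four vertices to be complete.\<close>

lemma legal_small:
  assumes "position n E P" "closed_under E Z" "Z \<subseteq> {..<n}" "card Z \<le> 4"
    and "x \<in> Z" "y \<in> Z" "x \<noteq> y" "{x, y} \<notin> E"
  shows "{x, y} \<in> legal_moves n (path_graph 5) E"
proof -
  have "finite Z" using assms(3) finite_subset by blast
  then have "\<not> has_P5 (insert {x, y} E)"
    using assms by (intro not_P5_insert_small[of E Z] position_not_P5) auto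
  then show ?thesis
    using assms by (auto simp: legal_moves_P5 position_nsets)
qed

lemma legal_small_block:
  assumes "position n E P" "C \<in> P" "card C \<le> 4" "x \<in> C" "y \<in> C" "x \<noteq> y" "{x, y} \<notin> E"
  shows "{x, y} \<in> legal_moves n (path_graph 5) E"
  using legal_small[OF assms(1) position_closed[OF assms(1,2)]] position_block[OF assms(1,2)] assms
  by blast

lemma not_edge_between:
  assumes "position n E P" "C \<in> P" "D \<in> P" "C \<noteq> D" "x \<in> C" "y \<in> D"
  shows "{x, y} \<notin> E" "x \<noteq> y" "x \<notin> D" "y \<notin> C"
proof -
  show "x \<notin> D" "y \<notin> C" using position_disjoint assms by blast+
  then show "{x, y} \<notin> E" "x \<noteq> y"
    using closed_underD[OF position_closed[OF assms(1,2)]] assms by auto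
qed

lemma card_Un_blocks:
  assumes "position n E P" "C \<in> P" "D \<in> P" "C \<noteq> D"
  shows "card (C \<union> D) = card C + card D"
  using not_edge_between(3)[OF assms] position_block[OF assms(1)] assms
  by (intro card_Un_disjoint) auto

lemma legal_small_blocks:
  assumes "position n E P" "C \<in> P" "D \<in> P" "C \<noteq> D" "card C + card D \<le> 4" "x \<in> C" "y \<in> D"
  shows "{x, y} \<in> legal_moves n (path_graph 5) E"
proof (rule legal_small[OF assms(1), of "C \<union> D"])
  show "closed_under E (C \<union> D)"
    using assms position_closed by (blast intro: closed_under_Un)
  show "C \<union> D \<subseteq> {..<n}" using position_block(3) assms by blast
  show "card (C \<union> D) \<le> 4" using card_Un_blocks assms by metis
qed (use assms not_edge_between[OF assms(1-4,6,7)] in auto)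

section \<open>How a move changes the blocks\<close>

lemma position_internal:
  assumes "position n E P" "e \<in> legal_moves n (path_graph 5) E" "C \<in> P" "e \<subseteq> C"
  shows "position n (insert e E) P"
  using assms legal_moves_P5[OF position_nsets[OF assms(1)]] unfolding position_def by blast

lemma position_merge:
  assumes pos: "position n E P" and e: "{u, v} \<in> legal_moves n (path_graph 5) E"
    and CD: "C \<in> P" "D \<in> P" "C \<noteq> D" and uv: "u \<in> C" "v \<in> D"
  shows "position n (insert {u, v} E) (merge P C D)"
proof -
  have "partition_on {..<n} (merge P C D)"
  proof (rule partition_onI)
    show "\<Union> (merge P C D) = {..<n}"
      using pos CD unfolding position_def partition_on_def merge_def by auto
    show "disjnt p q" if "p \<in> merge P C D" "q \<in> merge P C D" "p \<noteq> q" for p q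
      using that position_disjoint[OF pos] CD unfolding merge_def disjnt_def by blast
    show "{} \<notin> merge P C D"
      using position_block[OF pos] CD unfolding merge_def by auto
  qed
  moreover have "\<exists>X \<in> merge P C D. f \<subseteq> X" if f: "f \<in> insert {u, v} E" for f
  proof (cases "f = {u, v}")
    case True
    then show ?thesis using uv unfolding merge_def by auto
  next
    case False
    then obtain X where X: "X \<in> P" "f \<subseteq> X" using f position_edge[OF pos] by blast
    show ?thesis
    proof (cases "X \<in> {C, D}")
      case True
      then have "f \<subseteq> C \<union> D" using X(2) by blast
      then show ?thesis unfolding merge_def by blast
    next
      case False
      then show ?thesis using X unfolding merge_def by blast
    qed
  qed
  ultimately show ?thesis
    using e legal_moves_P5[OF position_nsets[OF pos]] position_nsets[OF pos]
    unfolding position_def by blast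
qed

text \<open>Stated by addition to avoid truncated subtraction on natural numbers.\<close>

lemma sum_merge:
  fixes f :: "nat set \<Rightarrow> nat"
  assumes pos: "position n E P" and CD: "C \<in> P" "D \<in> P" "C \<noteq> D"
  shows "sum f (merge P C D) + f C + f D = sum f P + f (C \<union> D)"
proof -
  have fin: "finite P" by (rule position_finite[OF pos])
  \<comment> \<open>Otherwise inserting the union into the remaining blocks would not add a new
    summand.\<close>
  have "C \<union> D \<notin> P"
  proof
    assume "C \<union> D \<in> P"
    then have "C \<union> D = C" "C \<union> D = D"
      using position_disjoint[OF pos] position_block(2)[OF pos] CD by blast+
    then show False using CD(3) by simp
  qed
  then have "sum f (merge P C D) = f (C \<union> D) + sum f (P - {C, D})"
    unfolding merge_def using fin by simp
  moreover have "sum f P = f C + (f D + sum f (P - {C} - {D}))"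
    using sum.remove[OF fin CD(1), of f] sum.remove[of "P - {C}" D f] fin CD by simp
  ultimately show ?thesis by (simp add: Diff_insert2[symmetric])
qed

lemma legal_move_cases:
  assumes pos: "position n E P" and e: "e \<in> legal_moves n (path_graph 5) E"
  obtains (internal) u v C where "e = {u, v}" "u \<noteq> v" "C \<in> P" "u \<in> C" "v \<in> C"
  | (merge) u v C D where "e = {u, v}" "C \<in> P" "D \<in> P" "C \<noteq> D" "u \<in> C" "v \<in> D"
proof -
  obtain u v where uv: "e = {u, v}" "u \<noteq> v" "u < n" "v < n"
    using e by (auto simp: legal_moves_def elim: nsets2_E)
  then obtain C D where "C \<in> P" "u \<in> C" "D \<in> P" "v \<in> D"
    using position_cover[OF pos] by meson
  then show thesis using that uv by (cases "C = D") blast+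
qed

lemma position_singletons: "position n {} ((\<lambda>x. {x}) ` {..<n})"
proof -
  have "partition_on {..<n} ((\<lambda>x. {x}) ` {..<n})"
    by (rule partition_onI) auto
  then show ?thesis by (simp add: position_def has_P5_def)
qed

text \<open>Written as a sum of indicators so that \<open>sum_merge\<close> describes its change
  under a move.\<close>

definition num_blocks :: "'a set set \<Rightarrow> nat \<Rightarrow> nat" where
  "num_blocks P k = (\<Sum>C\<in>P. of_bool (card C = k))"

lemma num_blocks_merge:
  assumes "position n E P" "C \<in> P" "D \<in> P" "C \<noteq> D"
  shows "num_blocks (merge P C D) k + of_bool (card C = k) + of_bool (card D = k) =
    num_blocks P k + of_bool (card C + card D = k)"
  using sum_merge[OF assms, of "\<lambda>X. of_bool (card X = k)"] card_Un_blocks[OF assms]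
  by (simp add: num_blocks_def)

lemma num_blocks_eq_card: "finite P \<Longrightarrow> num_blocks P k = card {C \<in> P. card C = k}"
  by (simp add: num_blocks_def of_bool_def sum.If_cases Int_def)

lemma num_blocks_ge_1:
  assumes "position n E P" "num_blocks P k \<ge> 1"
  obtains C where "C \<in> P" "card C = k"
proof -
  have "{C \<in> P. card C = k} \<noteq> {}"
    using assms num_blocks_eq_card[OF position_finite[OF assms(1)], of k] by (metis card.empty not_one_le_zero)
  then show thesis using that by blast
qed

lemma num_blocks_ge_2:
  assumes "position n E P" "num_blocks P k \<ge> 2"
  obtains C D where "C \<in> P" "D \<in> P" "C \<noteq> D" "card C = k" "card D = k"
proof -
  let ?A = "{C \<in> P. card C = k}"
  have "\<not> card ?A \<le> Suc 0" "finite ?A"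
    using assms num_blocks_eq_card[OF position_finite[OF assms(1)], of k] position_finite[OF assms(1)] by auto
  then obtain C D where "C \<in> ?A" "D \<in> ?A" "C \<noteq> D"
    using card_le_Suc0_iff_eq by blast
  then show thesis using that by blast
qed

lemma num_blocks_0: "position n E P \<Longrightarrow> num_blocks P k = 0 \<Longrightarrow> C \<in> P \<Longrightarrow> card C \<noteq> k"
  using position_finite[of n E P] by (auto simp: num_blocks_eq_card)

section \<open>Triangles inside blocks\<close>

lemma triangle_vertices:
  assumes "t \<in> triangles E" "x \<in> t"
  obtains y z where "t = {x, y, z}" "x \<noteq> y" "y \<noteq> z" "x \<noteq> z" "{x, y} \<in> E" "{y, z} \<in> E" "{x, z} \<in> E"
proof -
  have "card (t - {x}) = 2" using assms by (simp add: triangles_def)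
  then obtain y z where yz: "t - {x} = {y, z}" "y \<noteq> z" by (auto simp: card_2_iff)
  then have t: "t = {x, y, z}" "x \<noteq> y" "x \<noteq> z" using assms(2) by auto
  then have "{x, y} \<in> [t]\<^bsup>2\<^esup>" "{y, z} \<in> [t]\<^bsup>2\<^esup>" "{x, z} \<in> [t]\<^bsup>2\<^esup>" using yz(2) by auto
  moreover have "[t]\<^bsup>2\<^esup> \<subseteq> E" using assms(1) by (simp add: triangles_def)
  ultimately show thesis using that[OF t(1,2) yz(2) t(3)] by blast
qed

text \<open>Blocks are closed, so a triangle lies in one block, and being nonempty in only
  one.\<close>

lemma card_triangles:
  assumes pos: "position n E P"
  shows "card (triangles E) = (\<Sum>C\<in>P. card {t \<in> triangles E. t \<subseteq> C})"
proof -
  have "triangles E = (\<Union>C\<in>P. {t \<in> triangles E. t \<subseteq> C})"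
  proof (intro equalityI subsetI)
    fix t assume t: "t \<in> triangles E"
    then have "t \<noteq> {}" by (auto simp: triangles_def)
    then obtain x where "x \<in> t" by blast
    from t this obtain y z where yz: "t = {x, y, z}" "{x, y} \<in> E" "{x, z} \<in> E"
      by (rule triangle_vertices)
    obtain C where C: "C \<in> P" "{x, y} \<subseteq> C" using position_edge[OF pos yz(2)] by blast
    then have "t \<subseteq> C" using closed_underD[OF position_closed[OF pos C(1)] yz(3)] yz(1) by auto
    then show "t \<in> (\<Union>C\<in>P. {t \<in> triangles E. t \<subseteq> C})" using t C(1) by blast
  qed auto
  moreover have "card (\<Union>C\<in>P. {t \<in> triangles E. t \<subseteq> C}) = (\<Sum>C\<in>P. card {t \<in> triangles E. t \<subseteq> C})"
  proof (rule card_UN_disjoint[OF position_finite[OF pos]]; intro ballI impI)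
    show "finite {t \<in> triangles E. t \<subseteq> C}" if "C \<in> P" for C
      using position_block(1)[OF pos that] by simp
    show "{t \<in> triangles E. t \<subseteq> C} \<inter> {t \<in> triangles E. t \<subseteq> D} = {}"
      if CD: "C \<in> P" "D \<in> P" "C \<noteq> D" for C D
    proof -
      have "t = {}" if "t \<subseteq> C" "t \<subseteq> D" for t
        using position_disjoint[OF pos CD(1,2)] CD(3) that by blast
      moreover have "{} \<notin> triangles E" by (simp add: triangles_def)
      ultimately show ?thesis by blast
    qed
  qed
  ultimately show ?thesis by simp
qed

section \<open>The strategy of Mini\<close>

text \<open>Connectedness in the form of cuts. It supplies the edge leaving a given vertex set that
  is needed to prolong a path.\<close>

definition connected_block :: "'a set set \<Rightarrow> 'a set \<Rightarrow> bool" where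
  "connected_block E C \<longleftrightarrow> (\<forall>S. S \<subset> C \<longrightarrow> S \<noteq> {} \<longrightarrow> (\<exists>u \<in> S. \<exists>v \<in> C - S. {u, v} \<in> E))"

lemma connected_blockD:
  "connected_block E C \<Longrightarrow> S \<subset> C \<Longrightarrow> S \<noteq> {} \<Longrightarrow> \<exists>u \<in> S. \<exists>v \<in> C - S. {u, v} \<in> E"
  unfolding connected_block_def by simp

lemma connected_block_insert: "connected_block E C \<Longrightarrow> connected_block (insert e E) C"
  unfolding connected_block_def by blast

lemma connected_block_Un:
  assumes C: "connected_block E C" and D: "connected_block E D" and uv: "u \<in> C" "v \<in> D"
  shows "connected_block (insert {u, v} E) (C \<union> D)"
  unfolding connected_block_def
proof (intro allI impI)
  fix S assume S: "S \<subset> C \<union> D" "S \<noteq> {}"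
  \<comment> \<open>Either \<open>S\<close> splits one of the two blocks, or it equals one of them,
    and then the new edge crosses the cut.\<close>
  consider "S \<inter> C \<subset> C" "S \<inter> C \<noteq> {}" | "S \<inter> D \<subset> D" "S \<inter> D \<noteq> {}"
    | "C \<subseteq> S" "S \<inter> D = {}" | "D \<subseteq> S" "S \<inter> C = {}"
    using S by blast
  then show "\<exists>u' \<in> S. \<exists>v' \<in> C \<union> D - S. {u', v'} \<in> insert {u, v} E"
  proof cases
    case 1
    then show ?thesis using C unfolding connected_block_def by blast
  next
    case 2
    then show ?thesis using D unfolding connected_block_def by blast
  next
    case 3
    then have "u \<in> S" "v \<in> C \<union> D - S" using uv by auto
    then show ?thesis by blast
  next
    case 4
    then have "v \<in> S" "u \<in> C \<union> D - S" "{v, u} = {u, v}" using uv by auto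
    then show ?thesis by (metis insertI1)
  qed
qed

text \<open>The path enters the triangle at \<open>a\<close> and runs through its other two
  vertices.\<close>

lemma triangle_tail_P5:
  assumes "t \<in> triangles E" "a \<in> t" "w \<notin> t" "z \<notin> t" "z \<noteq> w" "{z, w} \<in> E" "{w, a} \<in> E"
  shows "has_P5 E"
proof -
  obtain b c where "t = {a, b, c}" "a \<noteq> b" "b \<noteq> c" "a \<noteq> c" "{a, b} \<in> E" "{b, c} \<in> E"
    using triangle_vertices[OF assms(1,2)] by metis
  then show ?thesis using assms by (intro has_P5I[of z w a b c]) auto
qed

text \<open>Two triangles sharing an edge span a diamond, to which connectedness attaches a fifth
  vertex. Two triangles sharing at most one vertex give a triangle with a tail of two edges. Both
  contain a P5.\<close>

lemma card_triangles_le_1: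
  assumes C: "connected_block E C" "finite C" "card C \<ge> 5" and P5: "\<not> has_P5 E"
  shows "card {t \<in> triangles E. t \<subseteq> C} \<le> 1"
proof -
  have "s = t" if s: "s \<in> triangles E" "s \<subseteq> C" and t: "t \<in> triangles E" "t \<subseteq> C" for s t
  proof (rule ccontr)
    assume "s \<noteq> t"
    have c3: "card s = 3" "card t = 3" using s t by (auto simp: triangles_def)
    then have fin: "finite s" "finite t" by (auto intro: card_ge_0_finite)
    have "t - s \<noteq> {}"
      using \<open>s \<noteq> t\<close> c3 card_subset_eq[OF fin(1), of t] by auto
    then obtain y where y: "y \<in> t" "y \<notin> s" by blast
    from t(1) y(1) obtain p q where pq: "t = {y, p, q}" "y \<noteq> p" "p \<noteq> q" "y \<noteq> q"
      "{y, p} \<in> E" "{p, q} \<in> E" "{y, q} \<in> E"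
      by (rule triangle_vertices)
    show False
    proof (cases "p \<in> s \<and> q \<in> s")
      case True
      have "\<exists>r. s - {p, q} = {r}"
        using True pq(3) c3(1) fin by (simp add: card_1_singleton_iff[symmetric] card_Diff_subset)
      then obtain r where r: "s - {p, q} = {r}" by blast
      then have s_eq: "s = {r, p, q}" and rpq: "r \<noteq> p" "r \<noteq> q" using True by auto
      then have ry: "r \<noteq> y" using y(2) by auto
      have "[s]\<^bsup>2\<^esup> \<subseteq> E" using s(1) by (simp add: triangles_def)
      moreover have "{r, p} \<in> [s]\<^bsup>2\<^esup>" "{r, q} \<in> [s]\<^bsup>2\<^esup>" using s_eq rpq by auto
      ultimately have rE: "{r, p} \<in> E" "{r, q} \<in> E" by blast+
      let ?Z = "{r, p, q, y}"
      have "card ?Z \<le> 4" by (simp add: card_insert_if)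
      then have "?Z \<noteq> C" using C(3) by auto
      then have "?Z \<subset> C" using s(2) t(2) s_eq y(1) by blast
      then have "\<exists>u \<in> ?Z. \<exists>v \<in> C - ?Z. {u, v} \<in> E"
        by (intro connected_blockD[OF C(1)]) simp_all
      then obtain u v where uv: "u \<in> ?Z" "v \<in> C - ?Z" "{u, v} \<in> E"
        by (elim bexE) (rule that)
      have vu: "{v, u} \<in> E" using uv(3) by (simp add: insert_commute)
      have E': "{p, r} \<in> E" "{q, r} \<in> E" "{p, y} \<in> E" "{q, y} \<in> E"
        using rE pq(5,7) by (simp_all add: insert_commute)
      \<comment> \<open>Each vertex of the diamond starts a Hamiltonian path of it, which the
        outside vertex \<open>v\<close> prolongs to a P5.\<close>
      consider "u = r" | "u = p" | "u = q" | "u = y" using uv(1) by blast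
      then have "has_P5 E"
      proof cases
        case 1
        then show ?thesis using uv(2) vu rE E' pq rpq ry by (intro has_P5I[of v r p y q]) auto
      next
        case 2
        then show ?thesis using uv(2) vu rE E' pq rpq ry by (intro has_P5I[of v p r q y]) auto
      next
        case 3
        then show ?thesis using uv(2) vu rE E' pq rpq ry by (intro has_P5I[of v q r p y]) auto
      next
        case 4
        then show ?thesis using uv(2) vu rE E' pq rpq ry by (intro has_P5I[of v y p r q]) auto
      qed
      then show False using P5 by blast
    next
      case False
      then obtain y' where y': "y' \<in> t" "y' \<notin> s" "y' \<noteq> y" "{y', y} \<in> E"
        using pq by (auto simp: insert_commute)
      \<comment> \<open>The closed neighbourhood of \<open>s\<close> in \<open>C\<close>. If it is
        all of \<open>C\<close>, the second triangle provides the tail; otherwise an edge leaving it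
        does.\<close>
      let ?U = "{x \<in> C. x \<in> s \<or> (\<exists>a \<in> s. {x, a} \<in> E)}"
      have "has_P5 E"
      proof (cases "?U = C")
        case True
        then obtain a where "a \<in> s" "{y, a} \<in> E" using y t(2) by blast
        then show ?thesis using triangle_tail_P5[OF s(1), of a y y'] y y' by blast
      next
        case False
        then have "?U \<subset> C" by blast
        moreover have "s \<noteq> {}" using c3(1) by auto
        then have "?U \<noteq> {}" using s(2) by blast
        ultimately have "\<exists>u \<in> ?U. \<exists>v \<in> C - ?U. {u, v} \<in> E"
          by (rule connected_blockD[OF C(1)])
        then obtain u v where uv: "u \<in> ?U" "v \<in> C - ?U" "{u, v} \<in> E"
          by (elim bexE) (rule that)
        have vu: "{v, u} \<in> E" using uv(3) by (simp add: insert_commute)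
        then have "u \<notin> s" using uv(2) by blast
        then obtain a where "a \<in> s" "{u, a} \<in> E" using uv(1) by blast
        then show ?thesis using triangle_tail_P5[OF s(1), of a u v] \<open>u \<notin> s\<close> uv vu by blast
      qed
      then show False using P5 by blast
    qed
  qed
  then show ?thesis
    using card_le_Suc0_iff_eq[of "{t \<in> triangles E. t \<subseteq> C}"] C(2) by simp
qed

section \<open>Bounding the number of triangles by block sizes\<close>

definition linked :: "nat \<Rightarrow> nat set set \<Rightarrow> nat set set \<Rightarrow> bool" where
  "linked n E P \<longleftrightarrow> position n E P \<and> (\<forall>C \<in> P. connected_block E C)"

lemma linked_internal:
  assumes "linked n E P" "e \<in> legal_moves n (path_graph 5) E" "C \<in> P" "e \<subseteq> C"
  shows "linked n (insert e E) P"
  using assms position_internal connected_block_insert unfolding linked_def by blast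

lemma linked_merge:
  assumes "linked n E P" "{u, v} \<in> legal_moves n (path_graph 5) E"
    and "C \<in> P" "D \<in> P" "C \<noteq> D" "u \<in> C" "v \<in> D"
  shows "linked n (insert {u, v} E) (merge P C D)"
  using assms position_merge[OF _ assms(2-)] connected_block_Un[of E C D u v]
    connected_block_insert[of E _ "{u, v}"]
  unfolding linked_def merge_def by blast

text \<open>A block of size 4 has at most four triangles, and \<open>3 * 4 = 4 + 8\<close>. Size 3
  gives at most one triangle, smaller blocks have none, and from size 5 on there is at most
  one.\<close>

lemma triangles_le_blocks:
  assumes "linked n E P" "C \<in> P"
  shows "3 * card {t \<in> triangles E. t \<subseteq> C} \<le> card C + 8 * of_bool (card C = 4)"
proof -
  have pos: "position n E P" and con: "connected_block E C"
    using assms by (auto simp: linked_def)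
  note fin = position_block(1)[OF pos assms(2)]
  show ?thesis
  proof (cases "card C \<ge> 5")
    case True
    then show ?thesis
      using card_triangles_le_1[OF con fin True position_not_P5[OF pos]] by simp
  next
    case False
    have "card {t \<in> triangles E. t \<subseteq> C} \<le> card {t. t \<subseteq> C \<and> card t = 3}"
      using fin by (intro card_mono) (auto simp: triangles_def)
    also have "\<dots> = card C choose 3" by (rule n_subsets[OF fin])
    finally have "card {t \<in> triangles E. t \<subseteq> C} \<le> card C choose 3" .
    moreover have "card C = 0 \<or> card C = 1 \<or> card C = 2 \<or> card C = 3 \<or> card C = 4"
      using False by linarith
    moreover have "4 choose 3 = (4 :: nat)" by (simp add: eval_nat_numeral)
    ultimately show ?thesis by (auto simp: eval_nat_numeral)
  qed
qed

lemma triangles_le: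
  assumes "linked n E P" "num_blocks P 4 \<le> 1"
  shows "3 * card (triangles E) \<le> n + 8"
proof -
  have pos: "position n E P" using assms(1) by (simp add: linked_def)
  have "3 * card (triangles E) = (\<Sum>C\<in>P. 3 * card {t \<in> triangles E. t \<subseteq> C})"
    by (simp add: card_triangles[OF pos] sum_distrib_left)
  also have "\<dots> \<le> (\<Sum>C\<in>P. card C + 8 * of_bool (card C = 4))"
    using assms(1) by (intro sum_mono triangles_le_blocks)
  also have "\<dots> = n + 8 * num_blocks P 4"
    by (simp add: sum.distrib position_card[OF pos] sum_distrib_left num_blocks_def)
  finally show ?thesis using assms(2) by linarith
qed

text \<open>No move increases \<open>2 b\<^sub>4 + 2 b\<^sub>1 + b\<^sub>2\<close>, where \<open>b\<^sub>k\<close> is the number of blocks of size \<open>k\<close>;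
  so from a safe position on, there is at most one block of size 4.\<close>

definition safe :: "nat set set \<Rightarrow> bool" where
  "safe P \<longleftrightarrow> 2 * num_blocks P 4 + 2 * num_blocks P 1 + num_blocks P 2 \<le> 3"

text \<open>A block of size 4 arises only as 1 + 3 or 2 + 2, and either way the lost blocks pay
  exactly the weight 2 of the new one.\<close>

lemma safe_merge:
  assumes "position n E P" "C \<in> P" "D \<in> P" "C \<noteq> D" "safe P"
  shows "safe (merge P C D)"
proof -
  have "card C \<ge> 1" "card D \<ge> 1" using position_block(4)[OF assms(1)] assms(2,3) by auto
  then show ?thesis
    using num_blocks_merge[OF assms(1-4), of 1] num_blocks_merge[OF assms(1-4), of 2]
      num_blocks_merge[OF assms(1-4), of 4] assms(5)
    unfolding safe_def by (auto simp: of_bool_def split: if_splits)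
qed

text \<open>In a connected block \<open>x\<close> is a leaf with neighbour \<open>c\<close>; this
  \<open>c\<close> is where Mini attaches an isolated vertex.\<close>

definition leaf_block :: "nat set set \<Rightarrow> nat set \<Rightarrow> bool" where
  "leaf_block E C \<longleftrightarrow> (\<exists>x \<in> C. \<exists>c \<in> C. x \<noteq> c \<and> (\<forall>z. {x, z} \<in> E \<longrightarrow> z = c))"

text \<open>Unless the position is safe, Mini leaves no block of size 4 and at most one of size 2.
  The alternatives with Mini to move are what one move of Max can make of that.\<close>

definition mini_inv :: "nat \<Rightarrow> player \<Rightarrow> nat set set \<Rightarrow> bool" where
  "mini_inv n p E \<longleftrightarrow> (\<exists>P. linked n E P \<and> (safe P \<or> (case p of
     Max_player \<Rightarrow> 2 * num_blocks P 4 + num_blocks P 2 \<le> 1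
   | Mini_player \<Rightarrow> num_blocks P 4 = 0 \<and> num_blocks P 2 \<le> 2 \<or>
       2 * num_blocks P 4 + num_blocks P 2 \<le> 3 \<and> (\<exists>C \<in> P. card C = 4 \<and> leaf_block E C))))"

lemma mini_inv_triangles:
  assumes "mini_inv n p E"
  shows "3 * card (triangles E) \<le> n + 8" "E \<subseteq> [{..<n}]\<^bsup>2\<^esup>"
proof -
  obtain P where P: "linked n E P" "2 * num_blocks P 4 + num_blocks P 2 \<le> 3"
    using assms unfolding mini_inv_def safe_def by (fastforce split: player.splits)
  then show "3 * card (triangles E) \<le> n + 8" by (intro triangles_le) auto
  show "E \<subseteq> [{..<n}]\<^bsup>2\<^esup>" using P(1) position_nsets unfolding linked_def by blast
qed

lemma leaf_block_merge:
  assumes pos: "position n E P" and CD: "C \<in> P" "D \<in> P" "C \<noteq> D" and uv: "u \<in> C" "v \<in> D"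
    and "card C = 1"
  shows "leaf_block (insert {u, v} E) (C \<union> D)"
proof -
  have C: "C = {u}" using assms(7) uv(1) by (auto simp: card_1_singleton_iff)
  have "z = v" if "{u, z} \<in> insert {u, v} E" for z
  proof (rule ccontr)
    assume "z \<noteq> v"
    then have z: "{u, z} \<in> E" using that by (auto simp: doubleton_eq_iff)
    then have "z = u" using closed_underD[OF position_closed[OF pos CD(1)] z] C by auto
    then show False using z position_nsets[OF pos] by (auto simp: nsets_def)
  qed
  moreover have "u \<noteq> v" using not_edge_between(2)[OF pos CD uv] .
  ultimately show ?thesis using uv unfolding leaf_block_def by blast
qed

lemma mini_inv_max_move:
  assumes inv: "mini_inv n Max_player E" and e: "e \<in> legal_moves n (path_graph 5) E"
  shows "mini_inv n Mini_player (insert e E)"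
proof -
  obtain P where P: "linked n E P" "safe P \<or> 2 * num_blocks P 4 + num_blocks P 2 \<le> 1"
    using inv by (auto simp: mini_inv_def)
  then have pos: "position n E P" by (simp add: linked_def)
  from pos e show ?thesis
  proof (cases rule: legal_move_cases)
    case (internal u v C)
    then have "linked n (insert e E) P" using linked_internal[OF P(1) e] by blast
    then show ?thesis using P(2) by (auto simp: mini_inv_def)
  next
    case (merge u v C D)
    have L: "linked n (insert e E) (merge P C D)"
      using linked_merge[OF P(1)] e merge by blast
    note nb = num_blocks_merge[OF pos merge(2-4)]
    have C1: "card C \<ge> 1" "card D \<ge> 1" using position_block(4)[OF pos] merge by auto
    show ?thesis
    proof (cases "safe P")
      case True
      then show ?thesis using L safe_merge[OF pos merge(2-4)] by (auto simp: mini_inv_def)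
    next
      case False
      then have q: "num_blocks P 4 = 0" "num_blocks P 2 \<le> 1" using P(2) by auto
      show ?thesis
      proof (cases "card C + card D = 4")
        case True
        \<comment> \<open>With at most one block of size 2, the new block of size 4 arises as 1 + 3
          and not as 2 + 2, so it has a leaf.\<close>
        then have "card C = 1 \<or> card D = 1"
          using nb[of 2] q(2) C1 by (auto simp: of_bool_def split: if_splits)
        then have "leaf_block (insert e E) (C \<union> D)"
          using leaf_block_merge[OF pos merge(2-6)]
            leaf_block_merge[OF pos merge(3,2) merge(4)[symmetric] merge(6,5)] merge(1)
          by (auto simp: insert_commute Un_commute)
        moreover have "C \<union> D \<in> merge P C D" by (simp add: merge_def)
        moreover have "card (C \<union> D) = 4" using card_Un_blocks[OF pos merge(2-4)] True by simp
        moreover have "2 * num_blocks (merge P C D) 4 + num_blocks (merge P C D) 2 \<le> 3"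
          using nb[of 2] nb[of 4] q C1 True by (auto simp: of_bool_def split: if_splits)
        ultimately show ?thesis using L by (auto simp: mini_inv_def)
      next
        case False
        then have "num_blocks (merge P C D) 4 = 0 \<and> num_blocks (merge P C D) 2 \<le> 2"
          using nb[of 2] nb[of 4] q by (auto simp: of_bool_def split: if_splits)
        then show ?thesis using L by (auto simp: mini_inv_def)
      qed
    qed
  qed
qed

text \<open>In a safe position every move is good. In an unsafe one an isolated vertex is left: if
  there is neither a block of size 4 nor one of size 2, Mini joins two isolated vertices; otherwise
  she joins one to a block of size 2, or to the neighbour of a leaf in the block of size 4.\<close>

lemma mini_inv_mini_move:
  assumes inv: "mini_inv n Mini_player E" and ne: "legal_moves n (path_graph 5) E \<noteq> {}"
  shows "\<exists>e \<in> legal_moves n (path_graph 5) E. mini_inv n Max_player (insert e E)"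
proof -
  let ?L = "legal_moves n (path_graph 5) E"
  obtain P where P: "linked n E P" and inv: "safe P \<or> num_blocks P 4 = 0 \<and> num_blocks P 2 \<le> 2 \<or>
       2 * num_blocks P 4 + num_blocks P 2 \<le> 3 \<and> (\<exists>C \<in> P. card C = 4 \<and> leaf_block E C)"
    using inv by (auto simp: mini_inv_def)
  have pos: "position n E P" using P by (simp add: linked_def)
  have step: ?thesis
    if "C \<in> P" "D \<in> P" "C \<noteq> D" "u \<in> C" "v \<in> D" "{u, v} \<in> ?L"
      and "2 * num_blocks (merge P C D) 4 + num_blocks (merge P C D) 2 \<le> 1" for C D u v
    using linked_merge[OF P that(6,1-5)] that(6,7) by (auto simp: mini_inv_def)
  have small: ?thesis
    if CD: "C \<in> P" "D \<in> P" "C \<noteq> D" "card C + card D \<le> 4"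
      and q: "2 * num_blocks (merge P C D) 4 + num_blocks (merge P C D) 2 \<le> 1" for C D
  proof -
    obtain u v where uv: "u \<in> C" "v \<in> D" using position_block(2)[OF pos] CD by blast
    show ?thesis by (rule step[OF CD(1-3) uv legal_small_blocks[OF pos CD uv] q])
  qed
  consider (safe) "safe P"
    | (empty) "\<not> safe P" "num_blocks P 4 = 0" "num_blocks P 2 = 0"
    | (edge) "\<not> safe P" "num_blocks P 4 = 0" "num_blocks P 2 \<ge> 1" "num_blocks P 2 \<le> 2"
    | (leaf) C where "\<not> safe P" "2 * num_blocks P 4 + num_blocks P 2 \<le> 3"
        "C \<in> P" "card C = 4" "leaf_block E C"
    using inv by (cases "num_blocks P 2 = 0") auto
  then show ?thesis
  proof cases
    case safe
    obtain e where e: "e \<in> ?L" using ne by blast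
    from pos e have "mini_inv n Max_player (insert e E)"
    proof (cases rule: legal_move_cases)
      case (internal u v C)
      then have "linked n (insert e E) P" using linked_internal[OF P e] by blast
      then show ?thesis using safe by (auto simp: mini_inv_def)
    next
      case (merge u v C D)
      then have "linked n (insert e E) (merge P C D)" using linked_merge[OF P] e by blast
      then show ?thesis using safe_merge[OF pos merge(2-4) safe] by (auto simp: mini_inv_def)
    qed
    then show ?thesis using e by blast
  next
    case empty
    then have "num_blocks P 1 \<ge> 2" by (simp add: safe_def)
    then obtain C D where CD: "C \<in> P" "D \<in> P" "C \<noteq> D" "card C = 1" "card D = 1"
      by (rule num_blocks_ge_2[OF pos])
    show ?thesis
      using num_blocks_merge[OF pos CD(1-3), of 2] num_blocks_merge[OF pos CD(1-3), of 4] CD empty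
      by (intro small[OF CD(1-3)]) simp_all
  next
    case edge
    then have "num_blocks P 1 \<ge> 1" by (simp add: safe_def)
    then obtain C where C: "C \<in> P" "card C = 1" by (rule num_blocks_ge_1[OF pos])
    obtain D where D: "D \<in> P" "card D = 2" using num_blocks_ge_1[OF pos edge(3)] .
    have CD: "C \<noteq> D" using C D by auto
    show ?thesis
      using num_blocks_merge[OF pos C(1) D(1) CD, of 2] num_blocks_merge[OF pos C(1) D(1) CD, of 4]
        C D edge
      by (intro small[OF C(1) D(1) CD]) simp_all
  next
    case leaf
    have b4: "num_blocks P 4 \<noteq> 0" using num_blocks_0[OF pos _ leaf(3)] leaf(4) by blast
    then have "num_blocks P 1 \<ge> 1" using leaf(1,2) by (simp add: safe_def)
    then obtain D where D: "D \<in> P" "card D = 1" by (rule num_blocks_ge_1[OF pos])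
    then obtain y where y: "D = {y}" by (auto simp: card_1_singleton_iff)
    obtain x c where xc: "x \<in> C" "c \<in> C" "x \<noteq> c" and x: "\<And>z. {x, z} \<in> E \<Longrightarrow> z = c"
      using leaf(5) unfolding leaf_block_def by blast
    have CD: "C \<noteq> D" using leaf(4) D(2) by auto
    have yD: "y \<in> D" using y by simp
    note yC = not_edge_between[OF pos leaf(3) D(1) CD xc(2) yD]
    \<comment> \<open>\<open>x\<close> and \<open>y\<close> are two leaves at \<open>c\<close>, so
      the new block of size 5 has no Hamiltonian path.\<close>
    have "\<not> has_P5 (insert {c, y} E)"
    proof (rule not_P5_insert_leaves)
      show "closed_under E (C \<union> D)"
        using position_closed[OF pos] leaf(3) D(1) by (blast intro: closed_under_Un)
      show "card (C \<union> D) = 5" using card_Un_blocks[OF pos leaf(3) D(1) CD] leaf(4) D(2) by simp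
      show "finite (C \<union> D)" using position_block(1)[OF pos] leaf(3) D(1) by blast
      show "x \<noteq> y" using xc(1) yC(4) by auto
      show "z = c" if "{x, z} \<in> insert {c, y} E" for z
        using that x[of z] \<open>x \<noteq> y\<close> xc(3) by (auto simp: doubleton_eq_iff)
      show "z = c" if "{y, z} \<in> insert {c, y} E" for z
      proof (rule ccontr)
        assume "z \<noteq> c"
        then have z: "{y, z} \<in> E" using that yC(2) by (auto simp: doubleton_eq_iff)
        then have "z = y" using closed_underD[OF position_closed[OF pos D(1)] z] y by auto
        then show False using z position_nsets[OF pos] by (auto simp: nsets_def)
      qed
    qed (use xc y position_not_P5[OF pos] in auto)
    moreover have "c < n" "y < n"
      using position_block(3)[OF pos leaf(3)] position_block(3)[OF pos D(1)] xc(2) yD by auto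
    ultimately have legal: "{c, y} \<in> ?L"
      using yC(1,2) by (simp add: legal_moves_P5[OF position_nsets[OF pos]])
    \<comment> \<open>The block of size 4 becomes one of size 5, which lowers the weight from at
      most 3 to at most 1.\<close>
    show ?thesis
      using num_blocks_merge[OF pos leaf(3) D(1) CD, of 2]
        num_blocks_merge[OF pos leaf(3) D(1) CD, of 4] leaf(2,4) D(2)
      by (intro step[OF leaf(3) D(1) CD xc(2) yD legal]) simp
  qed
qed

lemma linked_singletons: "linked n {} ((\<lambda>x. {x}) ` {..<n})"
  using position_singletons by (auto simp: linked_def connected_block_def)

lemma num_blocks_singletons: "k \<noteq> 1 \<Longrightarrow> num_blocks ((\<lambda>x. {x}) ` A) k = 0"
  by (auto simp: num_blocks_def intro!: sum.neutral)

lemma optimal_score_upper: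
  "3 * optimal_score n (complete_graph 3) (path_graph 5) p {} \<le> n + 8"
proof -
  have "mini_inv n p {}"
    using linked_singletons[of n]
    by (auto simp: mini_inv_def num_blocks_singletons split: player.splits intro!: exI[of _ "(\<lambda>x. {x}) ` {..<n}"])
  \<comment> \<open>The score is an integer, so the bound \<open>(n + 8) / 3\<close> may be rounded
    down.\<close>
  then have "optimal_score n (complete_graph 3) (path_graph 5) p {} \<le> (n + 8) div 3"
  proof (rule optimal_score_le[where Q = "mini_inv n", rotated -1])
    show "card (copies (complete_graph 3) ({..<n}, E)) \<le> (n + 8) div 3" if "mini_inv n p E" for p E
      using mini_inv_triangles[OF that] card_copies_K3[of E n] by simp
  qed (use mini_inv_max_move mini_inv_mini_move in blast)+
  then show ?thesis by simp
qed

section \<open>The strategy of Max\<close>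

definition is_path :: "'a set set \<Rightarrow> 'a list \<Rightarrow> bool" where
  "is_path E xs \<longleftrightarrow> distinct xs \<and> successively (\<lambda>x y. {x, y} \<in> E) xs"

text \<open>A Hamiltonian path is required from every vertex, which is stronger than the usual
  meaning of the word.\<close>

definition traceable :: "'a set set \<Rightarrow> 'a set \<Rightarrow> bool" where
  "traceable E C \<longleftrightarrow> (\<forall>u \<in> C. \<exists>xs. is_path E (u # xs) \<and> set (u # xs) = C)"

lemma is_path_insert: "is_path E xs \<Longrightarrow> is_path (insert e E) xs"
  unfolding is_path_def by (auto elim: successively_mono)

lemma traceable_insert: "traceable E C \<Longrightarrow> traceable (insert e E) C"
  unfolding traceable_def using is_path_insert by blast

lemma is_path_rev: "is_path E (rev xs) \<longleftrightarrow> is_path E xs"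
  unfolding is_path_def by (simp add: successively_rev insert_commute)

lemma is_path_append:
  assumes "is_path E xs" "is_path E ys" "set xs \<inter> set ys = {}" "{last xs, hd ys} \<in> E"
  shows "is_path E (xs @ ys)"
  using assms unfolding is_path_def by (auto simp: successively_append_iff)

lemma is_path_P5:
  assumes "is_path E xs" "length xs \<ge> 5"
  shows "has_P5 E"
proof -
  obtain a b c d e ys where xs: "xs = a # b # c # d # e # ys"
    using assms(2) by (auto simp: Suc_le_length_iff numeral_eq_Suc)
  show ?thesis
    using assms(1) unfolding xs is_path_def by (intro has_P5I[of a b c d e]) simp_all
qed

text \<open>A Hamiltonian cycle can be rotated to start at any vertex.\<close>

lemma traceable_cycle:
  assumes zs: "is_path E zs" "{last zs, hd zs} \<in> E"
  shows "traceable E (set zs)"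
  unfolding traceable_def
proof
  fix u assume "u \<in> set zs"
  then obtain as bs where z: "zs = as @ u # bs" by (meson split_list)
  have "is_path E ((u # bs) @ as)"
  proof (cases "as = []")
    case True
    then show ?thesis using zs(1) z by simp
  next
    case False
    have "is_path E (u # bs)" "is_path E as" "set (u # bs) \<inter> set as = {}"
      using zs(1) unfolding z is_path_def by (auto simp: successively_append_iff)
    moreover have "{last (u # bs), hd as} \<in> E" using zs(2) False unfolding z by simp
    ultimately show ?thesis by (rule is_path_append)
  qed
  moreover have "set (u # bs @ as) = set zs" using z by auto
  ultimately show "\<exists>xs. is_path E (u # xs) \<and> set (u # xs) = set zs" by (metis append_Cons)
qed

definition traced :: "nat \<Rightarrow> nat set set \<Rightarrow> nat set set \<Rightarrow> bool" where
  "traced n E P \<longleftrightarrow> position n E P \<and> (\<forall>C \<in> P. card C \<le> 4 \<and> traceable E C)"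

lemma traced_internal:
  assumes "traced n E P" "e \<in> legal_moves n (path_graph 5) E" "C \<in> P" "e \<subseteq> C"
  shows "traced n (insert e E) P"
  using assms position_internal traceable_insert unfolding traced_def by blast

text \<open>The reversed path from \<open>u\<close>, the new edge and the path from \<open>v\<close>
  are concatenated.\<close>

lemma hamiltonian_path_Un:
  assumes pos: "position n E P" and CD: "C \<in> P" "D \<in> P" "C \<noteq> D" and uv: "u \<in> C" "v \<in> D"
    and tr: "traceable E C" "traceable E D"
  obtains zs where "is_path (insert {u, v} E) zs" "set zs = C \<union> D" "length zs = card C + card D"
proof -
  obtain xs ys where xs: "is_path E (u # xs)" "set (u # xs) = C"
    and ys: "is_path E (v # ys)" "set (v # ys) = D"
    using tr uv unfolding traceable_def by meson
  let ?zs = "rev (u # xs) @ (v # ys)"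
  have "set (u # xs) \<inter> set (v # ys) = {}"
    using xs(2) ys(2) position_disjoint[OF pos CD(1,2)] CD(3) by blast
  then have zs: "is_path (insert {u, v} E) ?zs"
    using is_path_insert[OF xs(1)] is_path_insert[OF ys(1)]
    by (intro is_path_append) (simp_all only: is_path_rev set_rev, simp)
  have set: "set ?zs = C \<union> D" using xs(2) ys(2) by (simp only: set_append set_rev)
  have "length ?zs = card C + card D"
    using distinct_card[of ?zs] zs set card_Un_blocks[OF pos CD] by (simp only: is_path_def)
  then show thesis using that zs set by blast
qed

text \<open>The union has a Hamiltonian path, so five or more vertices would give a P5. Closing this
  path to a cycle restores traceability; if the closing edge is missing, it is a legal reply for
  Max.\<close>

lemma traced_merge:
  assumes tr: "traced n E P" and e: "{u, v} \<in> legal_moves n (path_graph 5) E"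
    and CD: "C \<in> P" "D \<in> P" "C \<noteq> D" and uv: "u \<in> C" "v \<in> D"
  shows "card C + card D \<le> 4"
    and "traced n (insert {u, v} E) (merge P C D) \<or>
      (\<exists>e \<in> legal_moves n (path_graph 5) (insert {u, v} E).
        traced n (insert e (insert {u, v} E)) (merge P C D))"
proof -
  let ?E = "insert {u, v} E" and ?P = "merge P C D"
  have pos: "position n E P" and trCD: "traceable E C" "traceable E D"
    using tr CD by (auto simp: traced_def)
  have pos': "position n ?E ?P" by (rule position_merge[OF pos e CD uv])
  obtain zs where zs: "is_path ?E zs" "set zs = C \<union> D" "length zs = card C + card D"
    by (rule hamiltonian_path_Un[OF pos CD uv trCD])
  show le: "card C + card D \<le> 4"
    using is_path_P5[OF zs(1)] position_not_P5[OF pos'] zs(3) by linarith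
  have card: "card (C \<union> D) \<le> 4" using card_Un_blocks[OF pos CD] le by simp
  \<comment> \<open>The inclusions say that \<open>E'\<close> is \<open>?E\<close> with the closing
    edge, which may already belong to \<open>?E\<close>.\<close>
  have closed: "traced n E' ?P"
    if "position n E' ?P" "insert {last zs, hd zs} ?E \<subseteq> E'" "E' \<subseteq> insert {last zs, hd zs} ?E" for E'
  proof -
    have E': "E' = insert {last zs, hd zs} ?E" using that by blast
    have "traceable E' (C \<union> D)"
      using traceable_cycle[of E' zs] is_path_insert[OF zs(1)] zs(2) unfolding E' by simp
    moreover have "traceable E' X" if "X \<in> P" for X
      using that tr unfolding traced_def E' by (simp add: traceable_insert)
    ultimately show ?thesis
      using that(1) tr card unfolding traced_def merge_def by blast
  qed
  show "traced n ?E ?P \<or> (\<exists>e \<in> legal_moves n (path_graph 5) ?E. traced n (insert e ?E) ?P)"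
  proof (cases "{last zs, hd zs} \<in> ?E")
    case True
    then show ?thesis using closed[OF pos'] by blast
  next
    case False
    have CDP: "C \<union> D \<in> ?P" by (simp add: merge_def)
    have len: "length zs \<ge> 2" using zs(3) position_block(4)[OF pos CD(1)] position_block(4)[OF pos CD(2)] by simp
    then obtain a b ys where ab: "zs = a # b # ys" by (auto simp: Suc_le_length_iff numeral_2_eq_2)
    then have "last zs \<noteq> hd zs" using zs(1) by (auto simp: is_path_def)
    moreover have ends: "last zs \<in> C \<union> D" "hd zs \<in> C \<union> D"
      using zs(2) ab last_in_set[of zs] hd_in_set[of zs] by auto
    ultimately have legal: "{last zs, hd zs} \<in> legal_moves n (path_graph 5) ?E"
      using legal_small_block[OF pos' CDP card] False by blast
    then have "position n (insert {last zs, hd zs} ?E) ?P"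
      using position_internal[OF pos' _ CDP] ends by blast
    then show ?thesis using closed legal by blast
  qed
qed

section \<open>Blocks that resist merging\<close>

definition long_start :: "'a set set \<Rightarrow> 'a \<Rightarrow> bool" where
  "long_start E u \<longleftrightarrow> (\<exists>b c. u \<noteq> b \<and> b \<noteq> c \<and> u \<noteq> c \<and> {u, b} \<in> E \<and> {b, c} \<in> E)"

lemma long_startI:
  "{u, b} \<in> E \<Longrightarrow> {b, c} \<in> E \<Longrightarrow> u \<noteq> b \<Longrightarrow> b \<noteq> c \<Longrightarrow> u \<noteq> c \<Longrightarrow> long_start E u"
  unfolding long_start_def by blast

lemma long_start_insert: "long_start E u \<Longrightarrow> long_start (insert e E) u"
  unfolding long_start_def by blast

text \<open>Two edges inside \<open>C\<close>, the new edge and one edge inside \<open>D\<close>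
  form a P5.\<close>

lemma long_start_merge:
  assumes pos: "position n E P" and CD: "C \<in> P" "D \<in> P" "C \<noteq> D" and uv: "u \<in> C" "v \<in> D"
    and u: "long_start E u" and w: "{v, w} \<in> E"
  shows "has_P5 (insert {u, v} E)"
proof -
  obtain b c where bc: "u \<noteq> b" "b \<noteq> c" "u \<noteq> c" "{u, b} \<in> E" "{b, c} \<in> E"
    using u unfolding long_start_def by blast
  have C: "b \<in> C" "c \<in> C"
    using closed_underD[OF position_closed[OF pos CD(1)] bc(4)]
      closed_underD[OF position_closed[OF pos CD(1)] bc(5)] uv(1) by auto
  have D: "w \<in> D" using closed_underD[OF position_closed[OF pos CD(2)] w] uv(2) by auto
  have "v \<noteq> w" using subsetD[OF position_nsets[OF pos] w] by simp
  moreover have "x \<noteq> y" if "x \<in> C" "y \<in> D" for x y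
    using not_edge_between(2)[OF pos CD that] .
  moreover have "{c, b} \<in> E" "{b, u} \<in> E" using bc by (simp_all add: insert_commute)
  ultimately show ?thesis
    using bc C D uv w by (intro has_P5I[of c b u v w]) auto
qed

text \<open>What is kept of \<open>traceable\<close> once Max no longer repairs merges. It excludes
  isolated vertices, and among robust blocks only two single edges can still be joined.\<close>

definition robust :: "'a set set \<Rightarrow> 'a set \<Rightarrow> bool" where
  "robust E C \<longleftrightarrow> card C = 2 \<and> C \<in> E \<or> card C \<ge> 3 \<and> (\<forall>u \<in> C. long_start E u)"

lemma robust_insert: "robust E C \<Longrightarrow> robust (insert e E) C"
  unfolding robust_def using long_start_insert[of E _ e] by auto

lemma robust_neighbour:
  assumes "robust E C" "u \<in> C"
  obtains w where "{u, w} \<in> E"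
proof (cases "card C = 2 \<and> C \<in> E")
  case True
  then obtain x y where "C = {x, y}" by (auto simp: card_2_iff)
  then show thesis using that[of x] that[of y] True assms(2) by (auto simp: insert_commute)
next
  case False
  then show thesis using assms that unfolding robust_def long_start_def by blast
qed

text \<open>Each end of the new edge has a neighbour in its own block, so neither end may start a
  path on three vertices. Hence both blocks are single edges, and in the resulting path on four
  vertices every vertex starts a path on three.\<close>

lemma robust_merge:
  assumes pos: "position n E P" and CD: "C \<in> P" "D \<in> P" "C \<noteq> D" and uv: "u \<in> C" "v \<in> D"
    and rob: "robust E C" "robust E D" and P5: "\<not> has_P5 (insert {u, v} E)"
  shows "card C = 2" "card D = 2" "robust (insert {u, v} E) (C \<union> D)"
proof -
  obtain x y where xy: "{u, x} \<in> E" "{v, y} \<in> E"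
    using robust_neighbour rob uv by metis
  have "\<not> long_start E u"
    using long_start_merge[OF pos CD uv _ xy(2)] P5 by blast
  then show C: "card C = 2" using rob(1) uv(1) unfolding robust_def by blast
  have "\<not> long_start E v"
    using long_start_merge[OF pos CD(2,1) CD(3)[symmetric] uv(2,1) _ xy(1)] P5
    by (auto simp: insert_commute)
  then show D: "card D = 2" using rob(2) uv(2) unfolding robust_def by blast
  have ne: "u \<noteq> x" "v \<noteq> y"
    using subsetD[OF position_nsets[OF pos] xy(1)] subsetD[OF position_nsets[OF pos] xy(2)] by auto
  have "x \<in> C" "y \<in> D"
    using closed_underD[OF position_closed[OF pos CD(1)] xy(1)]
      closed_underD[OF position_closed[OF pos CD(2)] xy(2)] uv by auto
  then have Ceq: "C = {u, x}" and Deq: "D = {v, y}"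
    using C D ne uv by (auto simp: card_2_iff)
  note ne' = not_edge_between(2)[OF pos CD uv] not_edge_between(2)[OF pos CD uv(1) \<open>y \<in> D\<close>]
    not_edge_between(2)[OF pos CD \<open>x \<in> C\<close> uv(2)] not_edge_between(2)[OF pos CD \<open>x \<in> C\<close> \<open>y \<in> D\<close>]
  let ?E = "insert {u, v} E"
  have edges: "{u, x} \<in> ?E" "{x, u} \<in> ?E" "{v, y} \<in> ?E" "{y, v} \<in> ?E" "{u, v} \<in> ?E" "{v, u} \<in> ?E"
    using xy by (simp_all add: insert_commute)
  have "long_start ?E u" by (rule long_startI[OF edges(5,3)]) (use ne ne' in auto)
  moreover have "long_start ?E v" by (rule long_startI[OF edges(6,1)]) (use ne ne' in auto)
  moreover have "long_start ?E x" by (rule long_startI[OF edges(2,5)]) (use ne ne' in auto)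
  moreover have "long_start ?E y" by (rule long_startI[OF edges(4,6)]) (use ne ne' in auto)
  moreover have "card (C \<union> D) \<ge> 3" using card_Un_blocks[OF pos CD] C D by simp
  ultimately show "robust ?E (C \<union> D)" unfolding robust_def Ceq Deq by auto
qed

lemma traceable_long_start:
  assumes "traceable E C" "card C \<ge> 3" "u \<in> C"
  shows "long_start E u"
proof -
  obtain xs where xs: "is_path E (u # xs)" "set (u # xs) = C"
    using assms(1,3) unfolding traceable_def by blast
  then have "length (u # xs) = card C"
    using distinct_card[of "u # xs"] by (simp only: is_path_def)
  then have "length (u # xs) \<ge> 3" using assms(2) by simp
  then obtain b c ys where "xs = b # c # ys"
    by (auto simp: Suc_le_length_iff numeral_3_eq_3)
  then show ?thesis using xs(1) by (intro long_startI[of u b _ c]) (auto simp: is_path_def)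
qed

lemma traceable_robust:
  assumes "traceable E C" "card C \<ge> 2"
  shows "robust E C"
proof (cases "card C \<ge> 3")
  case True
  then show ?thesis using traceable_long_start[OF assms(1)] by (simp add: robust_def)
next
  case False
  then have c2: "card C = 2" using assms(2) by simp
  then obtain u where u: "u \<in> C" by fastforce
  obtain xs where xs: "is_path E (u # xs)" "set (u # xs) = C"
    using assms(1) u unfolding traceable_def by blast
  then have "length (u # xs) = 2"
    using distinct_card[of "u # xs"] c2 by (simp only: is_path_def)
  then obtain b where "xs = [b]" by (auto simp: length_Suc_conv numeral_2_eq_2)
  then show ?thesis using xs c2 by (auto simp: robust_def is_path_def)
qed

text \<open>\<open>Z\<close> is the one block that may have size 5; \<open>Z = {}\<close> means that
  there is none, as blocks are nonempty.\<close>

definition bounded :: "nat set set \<Rightarrow> nat set set \<Rightarrow> nat set \<Rightarrow> bool" where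
  "bounded E P Z \<longleftrightarrow> (\<forall>C \<in> P. card C \<le> 4 \<or> C = Z \<and> card C = 5 \<and> (\<exists>t \<in> triangles E. t \<subseteq> C))"

lemma triangleI:
  assumes "x \<noteq> y" "x \<noteq> z" "y \<noteq> z" "{x, y} \<in> E" "{y, z} \<in> E" "{x, z} \<in> E"
  shows "{x, y, z} \<in> triangles E"
proof -
  have "N \<in> E" if N: "N \<in> [{x, y, z}]\<^bsup>2\<^esup>" for N
  proof -
    obtain p q where "N = {p, q}" "p \<in> {x, y, z}" "q \<in> {x, y, z}" "p \<noteq> q"
      using N by (rule nsets2_E)
    then have "N = {x, y} \<or> N = {y, z} \<or> N = {x, z}" by (auto simp: insert_commute)
    then show ?thesis using assms(4-6) by metis
  qed
  then show ?thesis using assms(1-3) by (auto simp: triangles_def)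
qed

lemma triangles_insert: "t \<in> triangles E \<Longrightarrow> t \<in> triangles (insert e E)"
  by (auto simp: triangles_def)

lemma bounded_insert: "bounded E P Z \<Longrightarrow> bounded (insert e E) P Z"
  unfolding bounded_def using triangles_insert[of _ E e] by blast

text \<open>At the end of the game blocks of at most four vertices are complete, so only those of
  size 1 or 2 have too few triangles, with a deficit of at most 2. The exceptional block has five
  vertices and a triangle, again a deficit of at most 2.\<close>

lemma block_le_triangles:
  assumes pos: "position n E P" and bd: "bounded E P Z" and stop: "legal_moves n (path_graph 5) E = {}"
    and C: "C \<in> P"
  shows "card C \<le> 3 * card {t \<in> triangles E. t \<subseteq> C} + 2 * of_bool (card C \<le> 2) + 2 * of_bool (C = Z)"
proof (cases "card C \<le> 4")
  case True
  note fin = position_block(1)[OF pos C]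
  have "{x, y} \<in> E" if "x \<in> C" "y \<in> C" "x \<noteq> y" for x y
    using legal_small_block[OF pos C True that] stop by blast
  then have "[C]\<^bsup>2\<^esup> \<subseteq> E" by (auto elim!: nsets2_E)
  then have "{t \<in> triangles E. t \<subseteq> C} = {t. t \<subseteq> C \<and> card t = 3}"
    using nsets_mono[of _ C 2] unfolding triangles_def by blast
  then have "card {t \<in> triangles E. t \<subseteq> C} = card C choose 3"
    using n_subsets[OF fin] by simp
  moreover have "card C = 0 \<or> card C = 1 \<or> card C = 2 \<or> card C = 3 \<or> card C = 4"
    using True by linarith
  moreover have "4 choose 3 = (4 :: nat)" by (simp add: eval_nat_numeral)
  ultimately show ?thesis by auto
next
  case False
  then have Z: "C = Z" "card C = 5" and "{t \<in> triangles E. t \<subseteq> C} \<noteq> {}"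
    using bd C unfolding bounded_def by auto
  moreover have "finite {t \<in> triangles E. t \<subseteq> C}" using position_block(1)[OF pos C] by simp
  ultimately have "card {t \<in> triangles E. t \<subseteq> C} \<ge> 1"
    by (simp add: Suc_le_eq card_gt_0_iff)
  then show ?thesis using Z by simp
qed

text \<open>Two blocks of at most two vertices could still be joined, so at the end there is at most
  one. Its deficit and that of \<open>Z\<close> add up to at most 4.\<close>

lemma triangles_ge:
  assumes pos: "position n E P" and bd: "bounded E P Z" and stop: "legal_moves n (path_graph 5) E = {}"
  shows "n \<le> 3 * card (triangles E) + 4"
proof -
  have fin: "finite P" by (rule position_finite[OF pos])
  have "C = D" if CD: "C \<in> P" "D \<in> P" "card C \<le> 2" "card D \<le> 2" for C D
  proof (rule ccontr)
    assume "C \<noteq> D"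
    moreover obtain x y where "x \<in> C" "y \<in> D" using position_block(2)[OF pos] CD by blast
    ultimately show False using legal_small_blocks[OF pos CD(1,2)] CD(3,4) stop by fastforce
  qed
  then have "card {C \<in> P. card C \<le> 2} \<le> 1"
    using card_le_Suc0_iff_eq[of "{C \<in> P. card C \<le> 2}"] fin by auto
  then have small: "(\<Sum>C\<in>P. of_bool (card C \<le> 2)) \<le> (1 :: nat)"
    using fin by (simp add: of_bool_def sum.If_cases Int_def)
  have big: "(\<Sum>C\<in>P. of_bool (C = Z)) \<le> (1 :: nat)"
    using fin by (simp add: of_bool_def sum.delta')
  have "n = (\<Sum>C\<in>P. card C)" by (simp add: position_card[OF pos])
  also have "\<dots> \<le> (\<Sum>C\<in>P. 3 * card {t \<in> triangles E. t \<subseteq> C} + 2 * of_bool (card C \<le> 2) + 2 * of_bool (C = Z))"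
    by (intro sum_mono block_le_triangles[OF assms])
  also have "\<dots> = 3 * card (triangles E) + 2 * (\<Sum>C\<in>P. of_bool (card C \<le> 2)) + 2 * (\<Sum>C\<in>P. of_bool (C = Z))"
    by (simp add: card_triangles[OF pos] sum.distrib sum_distrib_left)
  finally show ?thesis using small big by linarith
qed

section \<open>Positions that stay good under any play\<close>

definition settled :: "nat \<Rightarrow> nat set set \<Rightarrow> bool" where
  "settled n E \<longleftrightarrow> (\<exists>P Z. position n E P \<and> (\<forall>C \<in> P. robust E C) \<and> bounded E P Z)"

text \<open>This holds for moves of either player: a merge only turns two single edges into a robust
  block of size 4. From here on Max needs no strategy.\<close>

lemma settled_move:
  assumes "settled n E" and e: "e \<in> legal_moves n (path_graph 5) E"
  shows "settled n (insert e E)"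
proof -
  obtain P Z where pos: "position n E P" and rob: "\<And>C. C \<in> P \<Longrightarrow> robust E C" and bd: "bounded E P Z"
    using assms(1) unfolding settled_def by blast
  from pos e show ?thesis
  proof (cases rule: legal_move_cases)
    case (internal u v C)
    then show ?thesis
      using position_internal[OF pos e] robust_insert[OF rob] bounded_insert[OF bd]
      unfolding settled_def by blast
  next
    case (merge u v C D)
    let ?P = "merge P C D"
    have pos': "position n (insert e E) ?P" using position_merge[OF pos] e merge by blast
    then have P5: "\<not> has_P5 (insert {u, v} E)" using position_not_P5 merge(1) by blast
    note m = robust_merge[OF pos merge(2-6) rob[OF merge(2)] rob[OF merge(3)] P5]
    have "\<forall>X \<in> ?P. robust (insert e E) X"
      using m(3) robust_insert[OF rob] merge(1) unfolding merge_def by blast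
    moreover have "bounded (insert e E) ?P Z"
      using bounded_insert[OF bd, of e] card_Un_blocks[OF pos merge(2-4)] m(1,2)
      unfolding bounded_def merge_def by auto
    ultimately show ?thesis using pos' unfolding settled_def by blast
  qed
qed

lemma traced_settled:
  assumes "traced n E P" "num_blocks P 1 = 0"
  shows "settled n E"
proof -
  have pos: "position n E P" using assms(1) by (simp add: traced_def)
  have "card C \<ge> 2" if "C \<in> P" for C
    using num_blocks_0[OF pos assms(2) that] position_block(4)[OF pos that] by linarith
  then have "\<forall>C \<in> P. robust E C"
    using assms(1) traceable_robust unfolding traced_def by blast
  moreover have "bounded E P {}" using assms(1) by (auto simp: traced_def bounded_def)
  ultimately show ?thesis using pos unfolding settled_def by blast
qed

text \<open>This arises when Max joins the last isolated vertex \<open>a\<close> to the end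
  \<open>c\<close> of a single edge. The new block is not robust, as no path on three vertices
  starts at its centre \<open>c\<close>.\<close>

definition cherry :: "nat \<Rightarrow> nat set set \<Rightarrow> bool" where
  "cherry n E \<longleftrightarrow> (\<exists>P a c b. position n E P \<and> {a, c, b} \<in> P \<and> distinct [a, c, b] \<and>
     {a, c} \<in> E \<and> {b, c} \<in> E \<and> {a, b} \<notin> E \<and>
     (\<forall>C \<in> P - {{a, c, b}}. robust E C \<and> card C \<le> 4))"

definition max_inv_mini :: "nat \<Rightarrow> nat set set \<Rightarrow> bool" where
  "max_inv_mini n E \<longleftrightarrow> (\<exists>P. traced n E P) \<or> settled n E \<or> cherry n E"

text \<open>Mini's last move may have broken the invariant; the last alternative says that one reply
  of Max repairs it.\<close>

definition max_inv_max :: "nat \<Rightarrow> nat set set \<Rightarrow> bool" where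
  "max_inv_max n E \<longleftrightarrow> (\<exists>P. traced n E P) \<or> settled n E \<or>
     (\<exists>e \<in> legal_moves n (path_graph 5) E. max_inv_mini n (insert e E))"

text \<open>In a triangle every vertex starts a path on three vertices, so the block becomes robust.
  If the edge \<open>{a, b}\<close> is still missing, Max adds it.\<close>

lemma triangle_settled:
  assumes pos: "position n E P" and C: "{a, c, b} \<in> P" and d: "distinct [a, c, b]"
    and E: "{a, c} \<in> E" "{b, c} \<in> E"
    and rob: "\<And>X. X \<in> P \<Longrightarrow> X \<noteq> {a, c, b} \<Longrightarrow> robust E X \<and> card X \<le> 4"
  shows "settled n E \<or> (\<exists>e \<in> legal_moves n (path_graph 5) E. settled n (insert e E))"
proof -
  have card: "card {a, c, b} = 3" using d by simp
  have closed: "settled n E'"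
    if "position n E' P" "E' = insert {a, b} E" for E'
  proof -
    have edges: "{a, b} \<in> E'" "{b, a} \<in> E'" "{a, c} \<in> E'" "{c, a} \<in> E'" "{b, c} \<in> E'" "{c, b} \<in> E'"
      using E that(2) by (simp_all add: insert_commute)
    have "long_start E' a" by (rule long_startI[OF edges(1,5)]) (use d in auto)
    moreover have "long_start E' b" by (rule long_startI[OF edges(2,3)]) (use d in auto)
    moreover have "long_start E' c" by (rule long_startI[OF edges(4,1)]) (use d in auto)
    ultimately have "robust E' {a, c, b}" using card by (simp add: robust_def)
    moreover have "robust E' X" if "X \<in> P" "X \<noteq> {a, c, b}" for X
      using rob[OF that] robust_insert[of E X] \<open>E' = _\<close> by blast
    ultimately have "\<forall>X \<in> P. robust E' X" by blast
    moreover have "bounded E' P {}" using rob card unfolding bounded_def by fastforce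
    ultimately show ?thesis using that(1) unfolding settled_def by blast
  qed
  show ?thesis
  proof (cases "{a, b} \<in> E")
    case True
    then show ?thesis using closed[OF pos] by blast
  next
    case False
    have "{a, b} \<in> legal_moves n (path_graph 5) E"
      by (rule legal_small_block[OF pos C]) (use False d card in auto)
    then show ?thesis using closed position_internal[OF pos _ C] by blast
  qed
qed

text \<open>The second edge from Mini's 2-element block to the centre of the path makes a triangle
  with two pendant edges at one vertex, to which nothing but isolated vertices can be joined.\<close>

lemma cherry_absorb:
  assumes pos: "position n E P" and C: "{a, c, b} \<in> P" and d: "distinct [a, c, b]"
    and E: "{a, c} \<in> E" "{b, c} \<in> E" "{a, b} \<notin> E"
    and rob: "\<And>X. X \<in> P \<Longrightarrow> X \<noteq> {a, c, b} \<Longrightarrow> robust E X \<and> card X \<le> 4"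
    and D: "D \<in> P" "D \<noteq> {a, c, b}" and u: "u \<in> {a, c, b}" and v: "v \<in> D"
    and e: "{u, v} \<in> legal_moves n (path_graph 5) E"
  shows "\<exists>e \<in> legal_moves n (path_graph 5) (insert {u, v} E). settled n (insert e (insert {u, v} E))"
proof -
  let ?C = "{a, c, b}" and ?P = "merge P {a, c, b} D"
  let ?E = "insert {u, v} E"
  note CD = C D(1) D(2)[symmetric]
  have pos': "position n ?E ?P" by (rule position_merge[OF pos e CD u v])
  note P5 = position_not_P5[OF pos']
  obtain w where w: "{v, w} \<in> E" using robust_neighbour[of E D v] rob[OF D] v by blast
  have sym: "{c, a} \<in> E" "{c, b} \<in> E" using E by (simp_all add: insert_commute)
  \<comment> \<open>The ends of the path start paths on three vertices and \<open>v\<close> has a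
    neighbour, so Mini's edge can only meet the centre \<open>c\<close>.\<close>
  have "long_start E a" by (rule long_startI[OF E(1) sym(2)]) (use d in auto)
  moreover have "long_start E b" by (rule long_startI[OF E(2) sym(1)]) (use d in auto)
  ultimately have uc: "u = c"
    using long_start_merge[OF pos CD u v _ w] P5 u by blast
  \<comment> \<open>Since \<open>c\<close> has the neighbour \<open>a\<close>, the block
    \<open>D\<close> must be a single edge.\<close>
  have "\<not> long_start E v"
    using long_start_merge[OF pos CD(2,1) D(2) v u, of a] sym(1) uc P5 by (auto simp: insert_commute)
  then have D2: "card D = 2" using rob[OF D] v unfolding robust_def by blast
  have vw: "v \<noteq> w" using subsetD[OF position_nsets[OF pos] w] by simp
  have wD: "w \<in> D" using closed_underD[OF position_closed[OF pos D(1)] w] v by blast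
  then have Deq: "D = {v, w}" using D2 v vw by (auto simp: card_2_iff)
  have ne: "a \<noteq> v" "a \<noteq> w" "b \<noteq> v" "b \<noteq> w" "c \<noteq> v" "c \<noteq> w"
    using not_edge_between(2)[OF pos CD _ v] not_edge_between(2)[OF pos CD _ wD] by simp_all
  have cw: "{c, w} \<notin> E" using not_edge_between(1)[OF pos CD _ wD] by blast
  let ?Z = "?C \<union> D"
  have Z: "?Z \<in> ?P" by (simp add: merge_def)
  have Z5: "card ?Z = 5" using card_Un_blocks[OF pos CD] D2 d by simp
  \<comment> \<open>Both new edges are at \<open>c\<close>, so \<open>a\<close> and \<open>b\<close>
    remain leaves and the block of size 5 has no Hamiltonian path.\<close>
  have leaf: "z = c" if x: "x = a \<or> x = b" and z: "{x, z} \<in> insert {c, w} ?E" for x z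
  proof -
    have "x \<noteq> c" "x \<noteq> w" "x \<noteq> v" using x ne d by auto
    then have xz: "{x, z} \<in> E \<or> z = c" using z uc by (auto simp: doubleton_eq_iff)
    moreover have "z = c" if xzE: "{x, z} \<in> E"
    proof -
      have "z \<in> ?C" using closed_underD[OF position_closed[OF pos C] xzE] x by blast
      moreover have "x \<noteq> z" using subsetD[OF position_nsets[OF pos] xzE] by simp
      ultimately show ?thesis using xzE E(3) x by (auto simp: insert_commute)
    qed
    ultimately show ?thesis by blast
  qed
  have "\<not> has_P5 (insert {c, w} ?E)"
  proof (rule not_P5_insert_leaves[OF position_closed[OF pos' Z] _ P5 _ Z5])
    show "finite ?Z" using position_block(1)[OF pos' Z] .
    show "a \<in> ?Z" "b \<in> ?Z" "a \<noteq> b" "{c, w} \<subseteq> ?Z" using d wD by auto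
  qed (use leaf in blast)+
  moreover have "c < n" "w < n" using position_block(3)[OF pos' Z] wD by auto
  moreover have "{c, w} \<notin> ?E" using cw vw ne uc by (auto simp: doubleton_eq_iff)
  ultimately have legal: "{c, w} \<in> legal_moves n (path_graph 5) ?E"
    using ne by (simp add: legal_moves_P5[OF position_nsets[OF pos']])
  let ?F = "insert {c, w} ?E"
  have pos'': "position n ?F ?P" using position_internal[OF pos' legal Z] wD by blast
  have edges: "{a, c} \<in> ?F" "{b, c} \<in> ?F" "{c, v} \<in> ?F" "{v, w} \<in> ?F" "{w, v} \<in> ?F" "{v, c} \<in> ?F" "{c, w} \<in> ?F"
    using E w uc by (simp_all add: insert_commute)
  have "long_start ?F a" by (rule long_startI[OF edges(1,3)]) (use d ne in auto)
  moreover have "long_start ?F b" by (rule long_startI[OF edges(2,3)]) (use d ne in auto)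
  moreover have "long_start ?F c" by (rule long_startI[OF edges(3,4)]) (use d ne vw in auto)
  moreover have "long_start ?F v" by (rule long_startI[OF edges(6,7)]) (use d ne vw in auto)
  moreover have "long_start ?F w" by (rule long_startI[OF edges(5,6)]) (use d ne vw in auto)
  ultimately have "robust ?F ?Z" using Z5 unfolding robust_def Deq by auto
  moreover have robX: "robust ?F X \<and> card X \<le> 4" if "X \<in> ?P" "X \<noteq> ?Z" for X
    using that rob[of X] robust_insert unfolding merge_def by blast
  ultimately have "\<forall>X \<in> ?P. robust ?F X" by blast
  \<comment> \<open>The triangle \<open>{c, v, w}\<close> admits the merged block as the exceptional
    one.\<close>
  moreover have "bounded ?F ?P ?Z"
  proof -
    have "{c, v, w} \<in> triangles ?F"
      using ne(5,6) vw edges(3,4,7) by (intro triangleI)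
    moreover have "{c, v, w} \<subseteq> ?Z" using Deq by auto
    ultimately show ?thesis using robX Z5 unfolding bounded_def by blast
  qed
  ultimately show ?thesis using pos'' legal unfolding settled_def by blast
qed

text \<open>If Mini joins the path to another block, Max answers by \<open>cherry_absorb\<close>. If
  she plays inside a block or joins two others, Max closes the triangle unless it is already
  closed.\<close>

lemma cherry_mini_move:
  assumes "cherry n E" and e: "e \<in> legal_moves n (path_graph 5) E"
  shows "max_inv_max n (insert e E)"
proof -
  obtain P a c b where pos: "position n E P" and C: "{a, c, b} \<in> P" and d: "distinct [a, c, b]"
    and E: "{a, c} \<in> E" "{b, c} \<in> E" "{a, b} \<notin> E"
    and rob: "\<And>X. X \<in> P \<Longrightarrow> X \<noteq> {a, c, b} \<Longrightarrow> robust E X \<and> card X \<le> 4"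
    using assms(1) unfolding cherry_def by blast
  have *: "{a, c} \<in> insert e E" "{b, c} \<in> insert e E" using E by auto
  from pos e have "settled n (insert e E) \<or>
    (\<exists>f \<in> legal_moves n (path_graph 5) (insert e E). settled n (insert f (insert e E)))"
  proof (cases rule: legal_move_cases)
    case (internal u v K)
    then have "position n (insert e E) P" using position_internal[OF pos e] by blast
    then show ?thesis
      by (rule triangle_settled[OF _ C d *]) (use rob robust_insert in blast)
  next
    case (merge u v K L)
    have pos': "position n (insert e E) (merge P K L)"
      using position_merge[OF pos] e merge by blast
    consider "K = {a, c, b}" | "L = {a, c, b}" | "K \<noteq> {a, c, b}" "L \<noteq> {a, c, b}" by blast
    then show ?thesis
    proof cases
      case 1
      then show ?thesis
        using cherry_absorb[OF pos C d E rob merge(3) _ _ merge(6), of u] merge e by blast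
    next
      case 2
      have "e = {v, u}" using merge(1) by (simp add: insert_commute)
      then show ?thesis
        using cherry_absorb[OF pos C d E rob merge(2) _ _ merge(5), of v] merge(4,6) e 2 by blast
    next
      case 3
      have P5: "\<not> has_P5 (insert {u, v} E)" using position_not_P5[OF pos'] merge(1) by blast
      have "robust E K" "robust E L" using rob merge(2,3) 3 by blast+
      note m = robust_merge[OF pos merge(2-6) this P5]
      have "{a, c, b} \<in> merge P K L" using C 3 unfolding merge_def by blast
      then show ?thesis
      proof (rule triangle_settled[OF pos' _ d *])
        show "robust (insert e E) X \<and> card X \<le> 4" if "X \<in> merge P K L" "X \<noteq> {a, c, b}" for X
        proof (cases "X = K \<union> L")
          case True
          then show ?thesis using m card_Un_blocks[OF pos merge(2-4)] merge(1) by simp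
        next
          case False
          then show ?thesis using that rob robust_insert unfolding merge_def by blast
        qed
      qed
    qed
  qed
  then show ?thesis unfolding max_inv_max_def max_inv_mini_def by blast
qed

lemma max_inv_mini_move:
  assumes "max_inv_mini n E" and e: "e \<in> legal_moves n (path_graph 5) E"
  shows "max_inv_max n (insert e E)"
proof -
  consider (traced) P where "traced n E P" | (settled) "settled n E" | (cherry) "cherry n E"
    using assms(1) unfolding max_inv_mini_def by blast
  then show ?thesis
  proof cases
    case traced
    then have pos: "position n E P" by (simp add: traced_def)
    from pos e show ?thesis
    proof (cases rule: legal_move_cases)
      case (internal u v C)
      then show ?thesis using traced_internal[OF traced e] unfolding max_inv_max_def by blast
    next
      case (merge u v C D)
      then show ?thesis
        using traced_merge(2)[OF traced, of u v C D] e unfolding max_inv_max_def max_inv_mini_def by blast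
    qed
  next
    case settled
    then show ?thesis using settled_move[OF _ e] unfolding max_inv_max_def by blast
  next
    case cherry
    then show ?thesis using cherry_mini_move[OF _ e] by blast
  qed
qed

text \<open>Max pairs up isolated vertices while there are two. With none left, any move is good.
  With one left, he makes a cherry if there is a block of size 2; otherwise all other blocks have at
  least three vertices, and any legal move stays inside a block or joins the isolated vertex to a
  block of size 3.\<close>

lemma traced_max_move:
  assumes tr: "traced n E P" and ne: "legal_moves n (path_graph 5) E \<noteq> {}"
  shows "\<exists>e \<in> legal_moves n (path_graph 5) E. max_inv_mini n (insert e E)"
proof -
  let ?L = "legal_moves n (path_graph 5) E"
  have pos: "position n E P" and trP: "\<And>C. C \<in> P \<Longrightarrow> traceable E C" "\<And>C. C \<in> P \<Longrightarrow> card C \<le> 4"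
    using tr by (auto simp: traced_def)
  obtain e where e: "e \<in> ?L" using ne by blast
  consider (two) "num_blocks P 1 \<ge> 2" | (none) "num_blocks P 1 = 0"
    | (edge) "num_blocks P 1 = 1" "num_blocks P 2 \<ge> 1" | (one) "num_blocks P 1 = 1" "num_blocks P 2 = 0"
    by linarith
  then show ?thesis
  proof cases
    case two
    then obtain C D where CD: "C \<in> P" "D \<in> P" "C \<noteq> D" "card C = 1" "card D = 1"
      by (rule num_blocks_ge_2[OF pos])
    then obtain u v where uv: "C = {u}" "D = {v}" by (auto simp: card_1_singleton_iff)
    let ?E = "insert {u, v} E"
    have legal: "{u, v} \<in> ?L" by (rule legal_small_blocks[OF pos CD(1-3)]) (use CD uv in auto)
    have pos': "position n ?E (merge P C D)"
      by (rule position_merge[OF pos legal CD(1-3)]) (use uv in auto)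
    have "u \<noteq> v" using CD(3) uv by blast
    \<comment> \<open>The single edge is treated as a cycle on two vertices.\<close>
    then have "traceable ?E (set [u, v])"
      by (intro traceable_cycle) (simp_all add: is_path_def insert_commute)
    moreover have "C \<union> D = set [u, v]" "card (set [u, v]) \<le> 4" using uv by (auto simp: card_insert_if)
    ultimately have "traced n ?E (merge P C D)"
      using pos' trP traceable_insert unfolding traced_def merge_def by (metis insertE DiffD1)
    then show ?thesis using legal unfolding max_inv_mini_def by blast
  next
    case none
    then show ?thesis
      using settled_move[OF traced_settled[OF tr none] e] e unfolding max_inv_mini_def by blast
  next
    case edge
    obtain C where C: "C \<in> P" "card C = 1" using num_blocks_ge_1[OF pos, of 1] edge(1) by auto
    obtain D where D: "D \<in> P" "card D = 2" using num_blocks_ge_1[OF pos edge(2)] .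
    have CD: "C \<noteq> D" using C D by auto
    obtain a where a: "C = {a}" using C(2) by (auto simp: card_1_singleton_iff)
    obtain c b where cb: "D = {c, b}" "c \<noteq> b" using D(2) by (auto simp: card_2_iff)
    have "robust E D" using traceable_robust[OF trP(1)[OF D(1)]] D(2) by simp
    then have cbE: "{c, b} \<in> E" using D(2) cb(1) unfolding robust_def by auto
    let ?E = "insert {a, c} E" and ?P = "merge P C D"
    have ac: "a \<in> C" "c \<in> D" "b \<in> D" using a cb by auto
    have legal: "{a, c} \<in> ?L" by (rule legal_small_blocks[OF pos C(1) D(1) CD]) (use C D ac in auto)
    have pos': "position n ?E ?P" by (rule position_merge[OF pos legal C(1) D(1) CD ac(1,2)])
    have "num_blocks ?P 1 = 0"
      using num_blocks_merge[OF pos C(1) D(1) CD, of 1] edge(1) C D by simp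
    then have ge2: "card X \<ge> 2" if "X \<in> ?P" for X
      using num_blocks_0[OF pos' _ that, of 1] position_block(4)[OF pos' that] by linarith
    have rob: "robust ?E X \<and> card X \<le> 4" if X: "X \<in> ?P" "X \<noteq> C \<union> D" for X
    proof -
      have "X \<in> P" using X unfolding merge_def by blast
      then show ?thesis
        using robust_insert[OF traceable_robust[OF trP(1) ge2[OF X(1)]]] trP(2) by blast
    qed
    have eq: "C \<union> D = {a, c, b}" using a cb by auto
    have "{a, b} \<notin> ?E" "a \<noteq> b" "a \<noteq> c"
      using not_edge_between(1,2)[OF pos C(1) D(1) CD ac(1,3)]
        not_edge_between(2)[OF pos C(1) D(1) CD ac(1,2)] cb(2) by (auto simp: doubleton_eq_iff)
    moreover have "{b, c} \<in> ?E" using cbE by (simp add: insert_commute)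
    moreover have "{a, c, b} \<in> ?P" unfolding merge_def eq[symmetric] by simp
    ultimately have "cherry n ?E"
      unfolding cherry_def using pos' rob cb(2) unfolding eq
      by (intro exI[of _ ?P] exI[of _ a] exI[of _ c] exI[of _ b]) simp
    then show ?thesis using legal unfolding max_inv_mini_def by blast
  next
    case one
    have robust3: "robust E X" "card X \<ge> 3" if "X \<in> P" "card X \<noteq> 1" for X
    proof -
      show "card X \<ge> 3"
        using num_blocks_0[OF pos one(2) that(1)] position_block(4)[OF pos that(1)] that(2) by linarith
      then show "robust E X" using traceable_robust[OF trP(1)[OF that(1)]] by simp
    qed
    \<comment> \<open>The last isolated vertex \<open>u\<close> then starts a path through two
      vertices of \<open>D\<close>, so that all blocks are robust.\<close>
    have join: "settled n (insert {u, v} E)"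
      if uv: "{u, v} \<in> ?L" "C \<in> P" "D \<in> P" "C \<noteq> D" "u \<in> C" "v \<in> D" "card C = 1" for u v C D
    proof -
      let ?E = "insert {u, v} E" and ?P = "merge P C D"
      have pos': "position n ?E ?P" by (rule position_merge[OF pos uv(1-6)])
      have nb: "num_blocks ?P 1 = 0" "card D \<noteq> 1"
        using num_blocks_merge[OF pos uv(2-4), of 1] one(1) uv(7)
          position_block(4)[OF pos uv(3)] by (auto simp: of_bool_def split: if_splits)
      note D = robust3[OF uv(3) nb(2)]
      have C: "C = {u}" using uv(5,7) by (auto simp: card_1_singleton_iff)
      have le: "card C + card D \<le> 4" by (rule traced_merge(1)[OF tr uv(1-6)])
      obtain w where w: "{v, w} \<in> E" using robust_neighbour[OF D(1) uv(6)] .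
      then have "w \<in> D" "v \<noteq> w"
        using closed_underD[OF position_closed[OF pos uv(3)] w] uv(6)
          subsetD[OF position_nsets[OF pos] w] by auto
      then have "long_start ?E u"
        using w not_edge_between(2)[OF pos uv(2-5)] uv(6)
        by (intro long_startI[of u v _ w]) auto
      moreover have "long_start ?E x" if "x \<in> D" for x
        using traceable_long_start[OF trP(1)[OF uv(3)] D(2) that] by (rule long_start_insert)
      moreover have "card (C \<union> D) \<ge> 3"
        using card_Un_blocks[OF pos uv(2-4)] D(2) by simp
      ultimately have "robust ?E (C \<union> D)" unfolding robust_def C by simp
      moreover have "robust ?E X" if "X \<in> ?P" "X \<noteq> C \<union> D" for X
      proof -
        have "X \<in> P" using that unfolding merge_def by blast
        then show ?thesis
          using robust3(1) num_blocks_0[OF pos' nb(1) that(1)] robust_insert by blast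
      qed
      ultimately have "\<forall>X \<in> ?P. robust ?E X" by blast
      moreover have "bounded ?E ?P {}"
        using trP(2) le card_Un_blocks[OF pos uv(2-4)] unfolding bounded_def merge_def by auto
      ultimately show ?thesis using pos' unfolding settled_def by blast
    qed
    from pos e have "max_inv_mini n (insert e E)"
    proof (cases rule: legal_move_cases)
      case (internal u v C)
      then show ?thesis using traced_internal[OF tr e] unfolding max_inv_mini_def by blast
    next
      case (merge u v C D)
      have "card C + card D \<le> 4" using traced_merge(1)[OF tr] merge e by blast
      then have "card C = 1 \<or> card D = 1"
        using robust3(2)[OF merge(2)] robust3(2)[OF merge(3)] by linarith
      then have "settled n (insert e E)"
        using join[of u v C D] join[of v u D C] merge e by (auto simp: insert_commute)
      then show ?thesis unfolding max_inv_mini_def by blast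
    qed
    then show ?thesis using e by blast
  qed
qed

lemma max_inv_max_move:
  assumes "max_inv_max n E" and ne: "legal_moves n (path_graph 5) E \<noteq> {}"
  shows "\<exists>e \<in> legal_moves n (path_graph 5) E. max_inv_mini n (insert e E)"
proof -
  consider (traced) P where "traced n E P" | (settled) "settled n E"
    | (reply) "\<exists>e \<in> legal_moves n (path_graph 5) E. max_inv_mini n (insert e E)"
    using assms(1) unfolding max_inv_max_def by blast
  then show ?thesis
  proof cases
    case traced
    then show ?thesis using traced_max_move ne by blast
  next
    case settled
    then show ?thesis using settled_move ne unfolding max_inv_mini_def by blast
  qed
qed

text \<open>Each case of the invariant provides blocks as in \<open>bounded\<close>, and
  \<open>triangles_ge\<close> applies.\<close>

lemma max_inv_mini_stop:
  assumes "max_inv_mini n E" "legal_moves n (path_graph 5) E = {}"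
  shows "n \<le> 3 * card (copies (complete_graph 3) ({..<n}, E)) + 4"
proof -
  obtain P Z where P: "position n E P" "bounded E P Z"
  proof -
    consider (traced) P where "traced n E P" | (settled) "settled n E" | (cherry) "cherry n E"
      using assms(1) unfolding max_inv_mini_def by blast
    then show thesis
    proof cases
      case traced
      then show ?thesis using that[of P "{}"] by (auto simp: traced_def bounded_def)
    next
      case settled
      then show ?thesis using that unfolding settled_def by blast
    next
      case cherry
      then obtain P a c b where P: "position n E P" "distinct [a, c, b]"
        and rob: "\<forall>C \<in> P - {{a, c, b}}. robust E C \<and> card C \<le> 4"
        unfolding cherry_def by blast
      have "card {a, c, b} \<le> 4" using P(2) by simp
      then have "bounded E P {}" using rob unfolding bounded_def by blast
      then show ?thesis using that P(1) by blast
    qed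
  qed
  then show ?thesis
    using triangles_ge[OF P assms(2)] card_copies_K3[OF position_nsets[OF P(1)]] by simp
qed

lemma max_inv_max_stop:
  "max_inv_max n E \<Longrightarrow> legal_moves n (path_graph 5) E = {} \<Longrightarrow>
    n \<le> 3 * card (copies (complete_graph 3) ({..<n}, E)) + 4"
  using max_inv_mini_stop[of n E] unfolding max_inv_max_def max_inv_mini_def by blast

lemma traced_singletons: "traced n {} ((\<lambda>x. {x}) ` {..<n})"
proof -
  have "traceable {} {x}" for x :: nat
    unfolding traceable_def is_path_def by (auto intro: exI[of _ "[]"])
  then show ?thesis using position_singletons[of n] by (auto simp: traced_def)
qed

lemma optimal_score_lower:
  "n \<le> 3 * optimal_score n (complete_graph 3) (path_graph 5) p {} + 4"
proof -
  let ?Q = "\<lambda>p. case p of Max_player \<Rightarrow> max_inv_max n | Mini_player \<Rightarrow> max_inv_mini n"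
  have "?Q p {}"
    using traced_singletons[of n]
    by (auto simp: max_inv_max_def max_inv_mini_def split: player.split)
  \<comment> \<open>For \<open>n \<ge> 2\<close> this is \<open>(n - 4) / 3\<close> rounded up; for
    smaller \<open>n\<close> truncated subtraction makes it 0.\<close>
  then have "(n - 2) div 3 \<le> optimal_score n (complete_graph 3) (path_graph 5) p {}"
  proof (rule optimal_score_ge[where Q = ?Q, rotated -1])
    fix p E assume "?Q p E" "legal_moves n (path_graph 5) E = {}"
    then have "n \<le> 3 * card (copies (complete_graph 3) ({..<n}, E)) + 4"
      using max_inv_max_stop max_inv_mini_stop by (auto split: player.splits)
    then show "(n - 2) div 3 \<le> card (copies (complete_graph 3) ({..<n}, E))"
      by linarith
  qed (use max_inv_mini_move max_inv_max_move in auto)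
  then show ?thesis by linarith
qed

text \<open>The empty position satisfies both invariants whoever moves first, so one argument serves
  both scores; \<open>(n + 8) / 3\<close> equals \<open>(n - 4) / 3 + 4\<close>.\<close>

theorem theorem1p7:
  fixes n :: nat
  shows "\<forall>s \<in> {s\<^sub>1, s\<^sub>2}.
    (real n - 4) / 3 \<le> real (s n (complete_graph 3) (path_graph 5)) \<and>
    real (s n (complete_graph 3) (path_graph 5)) \<le> (real n - 4) / 3 + 4"
proof -
  let ?s = "\<lambda>p. optimal_score n (complete_graph 3) (path_graph 5) p {}"
  have "(real n - 4) / 3 \<le> real (?s p) \<and> real (?s p) \<le> (real n - 4) / 3 + 4" for p
    using of_nat_mono[OF optimal_score_lower[of n p], where 'a = real]
      of_nat_mono[OF optimal_score_upper[of n p], where 'a = real] by (simp add: field_simps)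
  then show ?thesis by (simp add: s\<^sub>1_def s\<^sub>2_def)
qed

end
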